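(* Let $\mathcal{G}=([p],E)$ be a DAG, $\mathcal{I}$ a collection of intervention targets with $\emptyset\in\mathcal{I}$, and $\mathcal{M}_{\mathcal{I}}(\mathcal{G})$ the associated discrete interventional DAG model, with $\mathcal{I}$-factorization ideal $\mathcal{F}_{\mathcal{G},\mathcal{I}}$. If $\mathcal{G}$ is a perfect DAG and for all $I,J\in\mathcal{I}$ we have $I\cup J=\overline{\mathrm{an}}_{\mathcal{G}}(I\cup J)$, then $\mathcal{F}_{\mathcal{G},\mathcal{I}}$ is a toric ideal generated by a quadratic Gröbner basis with squarefree initial terms (with respect to some monomial order).
   Context: $\mathcal{G}=([p],E)$ is a directed acyclic graph on $[p]=\{1,\ldots,p\}$; $\mathrm{pa}_{\mathcal{G}}(j)$ is the set of parents of $j$. $\mathcal{G}$ is perfect if for every $k\in[p]$ any two distinct elements of $\mathrm{pa}_{\mathcal{G}}(k)$ are joined by an edge of $\mathcal{G}$. For $S\subset[p]$, $\overline{\mathrm{an}}_{\mathcal{G}}(S)$ is the union of $S$ with the set of all nodes having a directed path in $\mathcal{G}$ to some element of $S$. $(X_1,\ldots,X_p)$ are discrete random variables, $X_k$ having state space $[d_k]=\{1,\ldots,d_k\}$. For $S\subset[p]$, $\mathcal{R}_S=\prod_{i\in S}[d_i]$ and $\mathcal{R}=\mathcal{R}_{[p]}$; $\mathbf{x}_S$ is the restriction of $\mathbf{x}\in\mathcal{R}$ to $S$. $\mathcal{I}=\{I_0=\emptyset,I_1,\ldots,I_K\}$ is a collection of subsets of $[p]$ (intervention targets). The model $\mathcal{M}_{\mathcal{I}}(\mathcal{G})$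 is the set of sequences $(f^{(I)})_{I\in\mathcal{I}}$ of positive probability mass functions on $\mathcal{R}$, each factoring as $f^{(I)}(\mathbf{x})=\prod_j f^{(I)}(x_j\mid\mathbf{x}_{\mathrm{pa}_{\mathcal{G}}(j)})$, with $f^{(I)}(x_j\mid\mathbf{x}_{\mathrm{pa}_{\mathcal{G}}(j)})=f^{(J)}(x_j\mid\mathbf{x}_{\mathrm{pa}_{\mathcal{G}}(j)})$ whenever $j\notin I\cup J$. $D_{\mathcal{I}}=\{p^{(I)}_{\mathbf{x}}:\mathbf{x}\in\mathcal{R},I\in\mathcal{I}\}$ are indeterminates. $U_{\mathcal{G},\mathcal{I}}$ is the set of indeterminates $q^{(I)}_{j;x;\mathbf{y}}$ with $I\in\mathcal{I}$, $j\in[p]$, $x\in[d_j]$, $\mathbf{y}\in\mathcal{R}_{\mathrm{pa}_{\mathcal{G}}(j)}$; $a_I$ ($I\in\mathcal{I}$) are additional (homogenizing) indeterminates. $\mathfrak{q}_{\mathcal{I}}$ is the ideal generated by all $\sum_{x\in[d_j]}q^{(I)}_{j;x;\mathbf{y}}-1$ and all $q^{(I)}_{j;x;\mathbf{y}}-q^{(J)}_{j;x;\mathbf{y}}$ with $j\notin I\cup J$. The $\mathcal{I}$-factorization ideal $\mathcal{F}_{\mathcal{G},\mathcal{I}}$ is the kernel of the ring map $$\mathbb{R}[D_{\mathcal{I}}]\to\mathbb{R}[a_I,U_{\mathcal{G},\mathcal{I}}:I\in\mathcal{I}]/\mathfrak{q}_{\mathcal{I}},\qquad p^{(I)}_{\mathbf{x}}\mapsto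 a_I\prod_{j\in I}q^{(I)}_{j;x_j;\mathbf{x}_{\mathrm{pa}_{\mathcal{G}}(j)}}\prod_{j\notin I}q^{(\emptyset)}_{j;x_j;\mathbf{x}_{\mathrm{pa}_{\mathcal{G}}(j)}}.$$ A toric ideal is a prime ideal generated by binomials. A quadratic Gröbner basis is one consisting of polynomials of degree two. *)

theory Defs
  imports
    Complex_Main
    "HOL-Library.Poly_Mapping"
    "HOL-Library.FuncSet"
    "HOL-Algebra.QuotRing"
begin

section \<open>Polynomial rings over the reals\<close>

text \<open>
  A monomial is a finitely supported exponent vector, a polynomial a finitely supported map from
  monomials to coefficients; multiplication of poly mappings is convolution. Since the
  indeterminates are indexed by a set \<open>X\<close> and not by a whole type, the ring \<open>\<real>[X]\<close> is a
  record in the sense of HOL-Algebra, whose ideals, quotients and kernels are then the library's.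
\<close>

type_synonym 'v mono = "'v \<Rightarrow>\<^sub>0 nat"
type_synonym 'v mpoly = "'v mono \<Rightarrow>\<^sub>0 real"

definition monomials :: "'v set \<Rightarrow> 'v mono set" where
  "monomials X = {m. Poly_Mapping.keys m \<subseteq> X}"

definition poly_ring :: "'v set \<Rightarrow> 'v mpoly ring" where
  "poly_ring X =
     \<lparr>carrier = {f. Poly_Mapping.keys f \<subseteq> monomials X}, mult = (*), one = 1, zero = 0, add = (+)\<rparr>"

lemma poly_ring_simps [simp]:
  "f \<in> carrier (poly_ring X) \<longleftrightarrow> Poly_Mapping.keys f \<subseteq> monomials X"
  "f \<otimes>\<^bsub>poly_ring X\<^esub> g = f * g" "f \<oplus>\<^bsub>poly_ring X\<^esub> g = f + g"
  "\<one>\<^bsub>poly_ring X\<^esub> = 1" "\<zero>\<^bsub>poly_ring X\<^esub> = 0"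
  by (simp_all add: poly_ring_def)

lemma cring_poly_ring: "cring (poly_ring X)"
proof (rule cringI)
  show "abelian_group (poly_ring X)"
  proof (rule abelian_groupI)
    fix f assume f: "f \<in> carrier (poly_ring X)"
    then have "- f \<in> carrier (poly_ring X)"
      by (auto simp: in_keys_iff)
    then show "\<exists>g\<in>carrier (poly_ring X). g \<oplus>\<^bsub>poly_ring X\<^esub> f = \<zero>\<^bsub>poly_ring X\<^esub>"
      by (intro bexI[of _ "- f"]) simp_all
  qed (use keys_add in \<open>force simp: add_ac\<close>)+
  show "Group.comm_monoid (poly_ring X)"
  proof (rule comm_monoidI)
    fix f g assume "f \<in> carrier (poly_ring X)" "g \<in> carrier (poly_ring X)"
    moreover have "m + n \<in> monomials X" if "m \<in> monomials X" "n \<in> monomials X" for m n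
      using that keys_add[of m n] by (auto simp: monomials_def)
    ultimately show "f \<otimes>\<^bsub>poly_ring X\<^esub> g \<in> carrier (poly_ring X)"
      using keys_mult[of f g] by fastforce
  qed (auto simp: monomials_def mult_ac)
qed (simp add: distrib_right)

definition mono_poly :: "'v mono \<Rightarrow> 'v mpoly" where
  "mono_poly m = Poly_Mapping.single m 1"

definition var :: "'v \<Rightarrow> 'v mpoly" where
  "var v = mono_poly (Poly_Mapping.single v 1)"

text \<open>The \<open>\<real>\<close>-algebra homomorphism sending each indeterminate \<open>v\<close> to \<open>\<sigma> v\<close>.\<close>

definition poly_subst :: "('v \<Rightarrow> 'w mpoly) \<Rightarrow> 'v mpoly \<Rightarrow> 'w mpoly" where
  "poly_subst \<sigma> f =
     (\<Sum>m\<in>Poly_Mapping.keys f. Poly_Mapping.single 0 (Poly_Mapping.lookup f m) *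
        (\<Prod>v\<in>Poly_Mapping.keys m. \<sigma> v ^ Poly_Mapping.lookup m v))"

section \<open>Toric ideals and Groebner bases\<close>

definition binomial_poly :: "'v mpoly \<Rightarrow> bool" where
  "binomial_poly f \<longleftrightarrow> (\<exists>u v. u \<noteq> v \<and> f = mono_poly u - mono_poly v)"

definition toric_ideal :: "'v set \<Rightarrow> 'v mpoly set \<Rightarrow> bool" where
  "toric_ideal X I \<longleftrightarrow> primeideal I (poly_ring X) \<and>
     (\<exists>B \<subseteq> carrier (poly_ring X). (\<forall>b\<in>B. binomial_poly b) \<and> I = Idl\<^bsub>poly_ring X\<^esub> B)"

text \<open>\<open>(m, n) \<in> r\<close> means that \<open>m\<close> is at most \<open>n\<close>.\<close>

definition monomial_order :: "'v set \<Rightarrow> ('v mono \<times> 'v mono) set \<Rightarrow> bool" where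
  "monomial_order X r \<longleftrightarrow> well_order_on (monomials X) r \<and>
     (\<forall>m n. \<forall>k\<in>monomials X. (m, n) \<in> r \<longrightarrow> (m + k, n + k) \<in> r)"

text \<open>Only meaningful for nonzero \<open>f\<close>.\<close>

definition initial_mono :: "('v mono \<times> 'v mono) set \<Rightarrow> 'v mpoly \<Rightarrow> 'v mono" where
  "initial_mono r f =
     (THE m. m \<in> Poly_Mapping.keys f \<and> (\<forall>n\<in>Poly_Mapping.keys f. (n, m) \<in> r))"

definition initial_ideal ::
    "'v set \<Rightarrow> ('v mono \<times> 'v mono) set \<Rightarrow> 'v mpoly set \<Rightarrow> 'v mpoly set" where
  "initial_ideal X r F = Idl\<^bsub>poly_ring X\<^esub> {mono_poly (initial_mono r f) | f. f \<in> F \<and> f \<noteq> 0}"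

definition groebner_basis ::
    "'v set \<Rightarrow> ('v mono \<times> 'v mono) set \<Rightarrow> 'v mpoly set \<Rightarrow> 'v mpoly set \<Rightarrow> bool" where
  "groebner_basis X r G I \<longleftrightarrow> finite G \<and> G \<subseteq> I \<and> initial_ideal X r G = initial_ideal X r I"

definition mono_degree :: "'v mono \<Rightarrow> nat" where
  "mono_degree m = (\<Sum>v\<in>Poly_Mapping.keys m. Poly_Mapping.lookup m v)"

definition total_degree :: "'v mpoly \<Rightarrow> nat" where
  "total_degree f = Max (insert 0 (mono_degree ` Poly_Mapping.keys f))"

definition squarefree_mono :: "'v mono \<Rightarrow> bool" where
  "squarefree_mono m \<longleftrightarrow> (\<forall>v. Poly_Mapping.lookup m v \<le> 1)"

section \<open>Directed acyclic graphs\<close>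

definition dag :: "nat \<Rightarrow> (nat \<times> nat) set \<Rightarrow> bool" where
  "dag p E \<longleftrightarrow> E \<subseteq> {1..p} \<times> {1..p} \<and> acyclic E"

definition parents :: "(nat \<times> nat) set \<Rightarrow> nat \<Rightarrow> nat set" where
  "parents E j = {i. (i, j) \<in> E}"

definition perfect_dag :: "nat \<Rightarrow> (nat \<times> nat) set \<Rightarrow> bool" where
  "perfect_dag p E \<longleftrightarrow> dag p E \<and>
     (\<forall>k\<in>{1..p}. \<forall>i\<in>parents E k. \<forall>j\<in>parents E k. i \<noteq> j \<longrightarrow> (i, j) \<in> E \<or> (j, i) \<in> E)"

definition ancestral_closure :: "(nat \<times> nat) set \<Rightarrow> nat set \<Rightarrow> nat set" where
  "ancestral_closure E S = S \<union> {i. \<exists>s\<in>S. (i, s) \<in> E\<^sup>+}"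

section \<open>The factorization ideal of an interventional DAG model\<close>

text \<open>Partial states \<open>\<R>\<^sub>S\<close> are extensional functions on \<open>S\<close>, so that \<open>\<x>\<^sub>S\<close> is \<open>restrict x S\<close>.\<close>

definition states :: "(nat \<Rightarrow> nat) \<Rightarrow> nat set \<Rightarrow> (nat \<Rightarrow> nat) set" where
  "states d S = (\<Pi>\<^sub>E i\<in>S. {1..d i})"

text \<open>The pair \<open>(I, x)\<close> stands for the indeterminate \<open>p\<^sup>(\<^sup>I\<^sup>)\<^sub>x\<close>.\<close>

type_synonym prob_var = "nat set \<times> (nat \<Rightarrow> nat)"

text \<open>\<open>A I\<close> is the homogenizing indeterminate \<open>a\<^sub>I\<close>, and \<open>Q I j x y\<close> stands for the conditional
  probability, under intervention target \<open>I\<close>, of \<open>X\<^sub>j = x\<close> given that the parents are in state \<open>y\<close>.\<close>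

datatype param_var = A "nat set" | Q "nat set" nat nat "nat \<Rightarrow> nat"

definition prob_vars :: "nat \<Rightarrow> (nat \<Rightarrow> nat) \<Rightarrow> nat set set \<Rightarrow> prob_var set" where
  "prob_vars p d \<I> = \<I> \<times> states d {1..p}"

definition param_vars ::
    "nat \<Rightarrow> (nat \<Rightarrow> nat) \<Rightarrow> (nat \<times> nat) set \<Rightarrow> nat set set \<Rightarrow> param_var set" where
  "param_vars p d E \<I> = {A I | I. I \<in> \<I>} \<union>
     {Q I j x y | I j x y. I \<in> \<I> \<and> j \<in> {1..p} \<and> x \<in> {1..d j} \<and> y \<in> states d (parents E j)}"

definition param_ideal ::
    "nat \<Rightarrow> (nat \<Rightarrow> nat) \<Rightarrow> (nat \<times> nat) set \<Rightarrow> nat set set \<Rightarrow> param_var mpoly set" where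
  "param_ideal p d E \<I> = Idl\<^bsub>poly_ring (param_vars p d E \<I>)\<^esub>
     ({(\<Sum>x\<in>{1..d j}. var (Q I j x y)) - 1 | I j y.
         I \<in> \<I> \<and> j \<in> {1..p} \<and> y \<in> states d (parents E j)} \<union>
      {var (Q I j x y) - var (Q J j x y) | I J j x y.
         I \<in> \<I> \<and> J \<in> \<I> \<and> j \<in> {1..p} - (I \<union> J) \<and> x \<in> {1..d j} \<and> y \<in> states d (parents E j)})"

definition param_image ::
    "nat \<Rightarrow> (nat \<times> nat) set \<Rightarrow> prob_var \<Rightarrow> param_var mpoly" where
  "param_image p E = (\<lambda>(I, x). var (A I) *
     (\<Prod>j\<in>I. var (Q I j (x j) (restrict x (parents E j)))) *
     (\<Prod>j\<in>{1..p} - I. var (Q {} j (x j) (restrict x (parents E j)))))"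

definition factorization_map ::
    "nat \<Rightarrow> (nat \<Rightarrow> nat) \<Rightarrow> (nat \<times> nat) set \<Rightarrow> nat set set \<Rightarrow>
     prob_var mpoly \<Rightarrow> param_var mpoly set" where
  "factorization_map p d E \<I> f =
     param_ideal p d E \<I> +>\<^bsub>poly_ring (param_vars p d E \<I>)\<^esub> poly_subst (param_image p E) f"

definition factorization_ideal ::
    "nat \<Rightarrow> (nat \<Rightarrow> nat) \<Rightarrow> (nat \<times> nat) set \<Rightarrow> nat set set \<Rightarrow> prob_var mpoly set" where
  "factorization_ideal p d E \<I> =
     a_kernel (poly_ring (prob_vars p d \<I>))
       (poly_ring (param_vars p d E \<I>) Quot param_ideal p d E \<I>)
       (factorization_map p d E \<I>)"

end

theory Submission
  imports Defs
begin

text \<open>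
  Since \<open>J = \<emptyset>\<close> is allowed in the hypothesis, every target is ancestral. Positive parameters can then
  be normalised without changing the induced point: going through the nodes in reverse topological
  order, divide the parameters of a node by their sum and multiply this sum into the parameters of its
  last parent, which by perfectness sees all the other parents (a node without parents passes it to
  \<open>a\<^sub>I\<close>). As a polynomial vanishing at all positive points is zero, the relations \<open>\<Sum>q = 1\<close> play no role
  and the factorization ideal is the kernel of a monomial map.

  For this toric ideal, order the coordinates of \<open>(I, x)\<close> as \<open>I\<close> followed by the nodes in topological
  order. If \<open>a\<close> precedes \<open>b\<close> lexicographically, and at a later node they agree on the parents and the
  relevant target while the values decrease, then exchanging this node together with the descendants
  that notice the difference gives a pair \<open>a'\<close>, \<open>b'\<close> with the same image. Encoding coordinates as digits
  of a number, \<open>a' < a < b < b'\<close> and \<open>a' + b' = a + b\<close>, so the move decreases the weight \<open>C - a\<^sup>2\<close>. A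
  monomial without such pairs is determined by its image; hence these quadrics form a Groebner basis
  for every order refining the weight, and their initial terms \<open>a b\<close> have \<open>a \<noteq> b\<close>.
\<close>

lemma poly_mapping_sum_single:
  "f = (\<Sum>m\<in>Poly_Mapping.keys f. Poly_Mapping.single m (Poly_Mapping.lookup f m))"
  by (rule poly_mapping_eqI)
    (simp add: lookup_sum lookup_single when_def in_keys_iff sum.delta)

section \<open>Evaluation of polynomials and its kernel\<close>

section \<open>Algebra homomorphisms out of polynomial rings\<close>

text \<open>Scalars and monomials are mapped separately, so that one construction covers monomial
  maps into polynomial rings (\<open>\<kappa>\<close> embeds constants) and evaluation at real
  points (\<open>\<kappa>\<close> is the identity).\<close>

locale alg_hom =
  fixes \<kappa> :: "real \<Rightarrow> 'r::comm_ring_1" and \<chi> :: "'v mono \<Rightarrow> 'r"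
  assumes scalar_zero: "\<kappa> 0 = 0" and scalar_one: "\<kappa> 1 = 1"
    and scalar_add: "\<kappa> (a + b) = \<kappa> a + \<kappa> b" and scalar_mult: "\<kappa> (a * b) = \<kappa> a * \<kappa> b"
    and char_zero: "\<chi> 0 = 1" and char_add: "\<chi> (m + n) = \<chi> m * \<chi> n"
begin

definition ext :: "'v mpoly \<Rightarrow> 'r" where
  "ext f = (\<Sum>m\<in>Poly_Mapping.keys f. \<kappa> (Poly_Mapping.lookup f m) * \<chi> m)"

lemma ext_superset:
  assumes "finite S" "Poly_Mapping.keys f \<subseteq> S"
  shows "ext f = (\<Sum>m\<in>S. \<kappa> (Poly_Mapping.lookup f m) * \<chi> m)"
  unfolding ext_def using assms
  by (intro sum.mono_neutral_left) (auto simp: in_keys_iff scalar_zero)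

lemma ext_zero [simp]: "ext 0 = 0"
  by (simp add: ext_def)

lemma ext_add: "ext (f + g) = ext f + ext g"
proof -
  let ?S = "Poly_Mapping.keys f \<union> Poly_Mapping.keys g"
  have "ext (f + g) = (\<Sum>m\<in>?S. \<kappa> (Poly_Mapping.lookup (f + g) m) * \<chi> m)"
    by (rule ext_superset) (use keys_add[of f g] in auto)
  also have "\<dots> = ext f + ext g"
    by (simp add: lookup_add scalar_add distrib_right sum.distrib ext_superset[of ?S])
  finally show ?thesis .
qed

lemma ext_sum: "ext (\<Sum>a\<in>B. F a) = (\<Sum>a\<in>B. ext (F a))"
  by (induction B rule: infinite_finite_induct) (simp_all add: ext_add)

lemma ext_diff: "ext (f - g) = ext f - ext g"
  using ext_add[of "f - g" g] by (simp add: eq_diff_eq)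

lemma ext_single: "ext (Poly_Mapping.single m c) = \<kappa> c * \<chi> m"
  by (simp add: ext_def scalar_zero)

lemma ext_mono_poly [simp]: "ext (mono_poly m) = \<chi> m"
  by (simp add: mono_poly_def ext_single scalar_one)

lemma ext_one [simp]: "ext 1 = 1"
  using ext_single[of 0 1] by (simp add: scalar_one char_zero)

lemma ext_mult: "ext (f * g) = ext f * ext g"
proof -
  have "ext (f * g) = (\<Sum>a\<in>Poly_Mapping.keys f. \<Sum>b\<in>Poly_Mapping.keys g.
      ext (Poly_Mapping.single a (Poly_Mapping.lookup f a) * Poly_Mapping.single b (Poly_Mapping.lookup g b)))"
    by (subst (1 2) poly_mapping_sum_single) (simp add: sum_product ext_sum)
  also have "\<dots> = ext f * ext g"
    unfolding mult_single ext_single scalar_mult char_add unfolding ext_def sum_product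
    by (simp add: mult_ac)
  finally show ?thesis .
qed

lemma ideal_ext_kernel: "ideal {f \<in> carrier (poly_ring X). ext f = 0} (poly_ring X)" (is "ideal ?T ?R")
proof -
  interpret R: cring ?R by (rule cring_poly_ring)
  show ?thesis
  proof (rule idealI[OF R.ring_axioms])
    show "subgroup ?T (add_monoid ?R)"
    proof (rule R.add.subgroupI)
      fix f assume "f \<in> ?T"
      moreover from this have "f \<oplus>\<^bsub>?R\<^esub> (\<ominus>\<^bsub>?R\<^esub> f) = \<zero>\<^bsub>?R\<^esub>"
        by (intro R.r_neg) blast
      ultimately show "\<ominus>\<^bsub>?R\<^esub> f \<in> ?T"
        using R.a_inv_closed[of f] ext_add[of f "\<ominus>\<^bsub>?R\<^esub> f"] by simp
    next
      fix f g assume "f \<in> ?T" "g \<in> ?T"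
      then show "f \<oplus>\<^bsub>?R\<^esub> g \<in> ?T"
        using R.a_closed[of f g] by (simp add: ext_add)
    qed (auto intro: exI[of _ 0])
  next
    fix f g assume "f \<in> ?T" "g \<in> carrier ?R"
    then show "g \<otimes>\<^bsub>?R\<^esub> f \<in> ?T" "f \<otimes>\<^bsub>?R\<^esub> g \<in> ?T"
      using R.m_closed[of f g] by (simp_all add: ext_mult mult.commute)
  qed
qed

end

lemma primeideal_ext_kernel:
  fixes \<kappa> :: "real \<Rightarrow> 'r::idom"
  assumes "alg_hom \<kappa> \<chi>"
  shows "primeideal {f \<in> carrier (poly_ring X). alg_hom.ext \<kappa> \<chi> f = 0} (poly_ring X)"
proof -
  interpret alg_hom \<kappa> \<chi> by (fact assms)
  show ?thesis
  proof (rule primeidealI[OF ideal_ext_kernel cring_poly_ring])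
    show "carrier (poly_ring X) \<noteq> {f \<in> carrier (poly_ring X). ext f = 0}"
    proof
      assume "carrier (poly_ring X) = {f \<in> carrier (poly_ring X). ext f = 0}"
      moreover have "1 \<in> carrier (poly_ring X)"
        by (simp add: monomials_def)
      ultimately have "ext 1 = 0" by blast
      then show False by simp
    qed
  qed (auto simp: ext_mult)
qed

section \<open>Monomial maps and their fibres\<close>

section \<open>Monomial maps\<close>

text \<open>Exponent vector of the image of \<open>m\<close> when each indeterminate
  \<open>v\<close> is sent to the product of its \<open>p + 1\<close> features; this additive map is
  the design matrix of a toric ideal.\<close>

definition feature_mono :: "(nat \<Rightarrow> 'v \<Rightarrow> 'w) \<Rightarrow> nat \<Rightarrow> 'v mono \<Rightarrow> 'w mono" where
  "feature_mono feat p m =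
     (\<Sum>v\<in>Poly_Mapping.keys m. \<Sum>t\<le>p. Poly_Mapping.single (feat t v) (Poly_Mapping.lookup m v))"

lemma feature_mono_superset:
  assumes "finite S" "Poly_Mapping.keys m \<subseteq> S"
  shows "feature_mono feat p m =
    (\<Sum>v\<in>S. \<Sum>t\<le>p. Poly_Mapping.single (feat t v) (Poly_Mapping.lookup m v))"
  unfolding feature_mono_def using assms
  by (intro sum.mono_neutral_left) (auto simp: in_keys_iff)

lemma feature_mono_zero [simp]: "feature_mono feat p 0 = 0"
  by (simp add: feature_mono_def)

lemma feature_mono_add: "feature_mono feat p (m + n) = feature_mono feat p m + feature_mono feat p n"
proof -
  let ?S = "Poly_Mapping.keys m \<union> Poly_Mapping.keys n"
  have "feature_mono feat p (m + n) =
      (\<Sum>v\<in>?S. \<Sum>t\<le>p. Poly_Mapping.single (feat t v) (Poly_Mapping.lookup (m + n) v))"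
    by (rule feature_mono_superset) (use keys_add[of m n] in auto)
  also have "\<dots> = feature_mono feat p m + feature_mono feat p n"
    by (simp add: lookup_add single_add sum.distrib feature_mono_superset[of ?S])
  finally show ?thesis .
qed

lemma feature_mono_single:
  "feature_mono feat p (Poly_Mapping.single v c) = (\<Sum>t\<le>p. Poly_Mapping.single (feat t v) c)"
  by (simp add: feature_mono_def)

lemma lookup_feature_mono:
  "Poly_Mapping.lookup (feature_mono feat p m) w =
     (\<Sum>v\<in>Poly_Mapping.keys m. \<Sum>t\<le>p. if feat t v = w then Poly_Mapping.lookup m v else 0)"
  by (simp add: feature_mono_def lookup_sum lookup_single when_def)

lemma in_keys_feature_mono:
  "w \<in> Poly_Mapping.keys (feature_mono feat p m) \<longleftrightarrow> (\<exists>v\<in>Poly_Mapping.keys m. \<exists>t\<le>p. feat t v = w)"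
  by (auto simp: in_keys_iff lookup_feature_mono)

lemma alg_hom_monomial_map:
  assumes "h 0 = 0" "\<And>m n. h (m + n) = h m + h n"
  shows "alg_hom (Poly_Mapping.single 0) (\<lambda>m. mono_poly (h m))"
  by unfold_locales (simp_all add: assms mono_poly_def single_add mult_single)

lemma mono_poly_add: "mono_poly (m + n) = mono_poly m * mono_poly n"
  by (simp add: mono_poly_def mult_single)

lemma mono_poly_sum: "mono_poly (\<Sum>a\<in>B. F a) = (\<Prod>a\<in>B. mono_poly (F a))"
  by (induction B rule: infinite_finite_induct) (simp_all add: mono_poly_add, simp_all add: mono_poly_def)

lemma mono_poly_feature_power:
  "mono_poly (\<Sum>t\<le>p. Poly_Mapping.single (feat t v) k) =
    mono_poly (\<Sum>t\<le>p. Poly_Mapping.single (feat t v) 1) ^ k"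
proof (induction k)
  case 0
  show ?case by (simp add: mono_poly_def)
next
  case (Suc k)
  have "(\<Sum>t\<le>p. Poly_Mapping.single (feat t v) (Suc k)) =
      (\<Sum>t\<le>p. Poly_Mapping.single (feat t v) 1) + (\<Sum>t\<le>p. Poly_Mapping.single (feat t v) k)"
    by (simp only: sum.distrib[symmetric] single_add[symmetric]) simp
  then show ?case
    using Suc by (simp add: mono_poly_add)
qed

lemma poly_subst_monomial_map:
  assumes "\<And>v. v \<in> X \<Longrightarrow> \<sigma> v = mono_poly (\<Sum>t\<le>p. Poly_Mapping.single (feat t v) 1)"
    and "f \<in> carrier (poly_ring X)"
  shows "poly_subst \<sigma> f =
    (\<Sum>m\<in>Poly_Mapping.keys f. Poly_Mapping.single 0 (Poly_Mapping.lookup f m) * mono_poly (feature_mono feat p m))"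
  unfolding poly_subst_def
proof (intro sum.cong refl arg_cong2[of _ _ _ _ "(*)"])
  fix m assume "m \<in> Poly_Mapping.keys f"
  then have "v \<in> X" if "v \<in> Poly_Mapping.keys m" for v
    using assms(2) that by (auto simp: monomials_def)
  then show "(\<Prod>v\<in>Poly_Mapping.keys m. \<sigma> v ^ Poly_Mapping.lookup m v) = mono_poly (feature_mono feat p m)"
    unfolding feature_mono_def mono_poly_sum[of _ "Poly_Mapping.keys m"]
    by (intro prod.cong refl) (simp only: assms(1) mono_poly_feature_power[symmetric])
qed

text \<open>The kernel of a monomial map only depends on which monomials it identifies.\<close>

lemma monomial_map_kernel:
  "(\<Sum>m\<in>Poly_Mapping.keys f. Poly_Mapping.single 0 (Poly_Mapping.lookup f m) * mono_poly (h m)) = 0 \<longleftrightarrow>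
    (\<forall>m\<in>Poly_Mapping.keys f. (\<Sum>n\<in>{n \<in> Poly_Mapping.keys f. h n = h m}. Poly_Mapping.lookup f n) = 0)"
  (is "?s = 0 \<longleftrightarrow> _")
proof -
  have coeff: "Poly_Mapping.lookup ?s u =
      (\<Sum>n\<in>{n \<in> Poly_Mapping.keys f. h n = u}. Poly_Mapping.lookup f n)" for u
    by (simp add: mono_poly_def mult_single lookup_sum lookup_single when_def sum.If_cases
        Collect_conj_eq Int_commute)
  show ?thesis
  proof
    assume R: "\<forall>m\<in>Poly_Mapping.keys f.
      (\<Sum>n\<in>{n \<in> Poly_Mapping.keys f. h n = h m}. Poly_Mapping.lookup f n) = 0"
    show "?s = 0"
    proof (rule poly_mapping_eqI)
      fix u
      show "Poly_Mapping.lookup ?s u = Poly_Mapping.lookup 0 u"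
      proof (cases "u \<in> h ` Poly_Mapping.keys f")
        case True
        then show ?thesis using R unfolding coeff by auto
      next
        case False
        then have empty: "{n \<in> Poly_Mapping.keys f. h n = u} = {}" by auto
        show ?thesis unfolding coeff empty by simp
      qed
    qed
  qed (simp flip: coeff)
qed

text \<open>Transports the linear order and the absence of zero divisors, which the library provides for
  ordered variables only.\<close>

lemma mono_encoding:
  assumes "finite (W :: 'w set)"
  obtains \<mu> :: "'w mono \<Rightarrow> nat mono"
  where "\<mu> 0 = 0" "\<And>m n. \<mu> (m + n) = \<mu> m + \<mu> n" "inj_on \<mu> (monomials W)"
proof -
  obtain \<epsilon> :: "'w \<Rightarrow> nat" where \<epsilon>: "inj_on \<epsilon> W"
    using finite_imp_inj_to_nat_seg[OF assms] by blast
  \<comment> \<open>A single feature per indeterminate makes \<open>feature_mono\<close> a renaming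
    along \<open>\<epsilon>\<close>.\<close>
  let ?\<mu> = "feature_mono (\<lambda>_. \<epsilon>) 0"
  have lookup: "Poly_Mapping.lookup (?\<mu> m) (\<epsilon> v) = Poly_Mapping.lookup m v"
    if "m \<in> monomials W" "v \<in> W" for m v
  proof -
    have "Poly_Mapping.lookup (?\<mu> m) (\<epsilon> v) =
        (\<Sum>u\<in>Poly_Mapping.keys m. if u = v then Poly_Mapping.lookup m u else 0)"
      unfolding lookup_feature_mono
    proof (intro sum.cong refl)
      fix u assume "u \<in> Poly_Mapping.keys m"
      then have "\<epsilon> u = \<epsilon> v \<longleftrightarrow> u = v"
        using that \<epsilon> by (auto simp: monomials_def inj_on_eq_iff subset_iff)
      then show "(\<Sum>t\<le>(0::nat). if \<epsilon> u = \<epsilon> v then Poly_Mapping.lookup m u else 0) =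
          (if u = v then Poly_Mapping.lookup m u else 0)"
        by simp
    qed
    then show ?thesis by (simp add: in_keys_iff)
  qed
  have "inj_on ?\<mu> (monomials W)"
  proof (rule inj_onI, rule poly_mapping_eqI)
    fix m n v assume mn: "m \<in> monomials W" "n \<in> monomials W" "?\<mu> m = ?\<mu> n"
    show "Poly_Mapping.lookup m v = Poly_Mapping.lookup n v"
    proof (cases "v \<in> W")
      case True
      then show ?thesis using mn lookup[of m v] lookup[of n v] by simp
    next
      case False
      then have "v \<notin> Poly_Mapping.keys m" "v \<notin> Poly_Mapping.keys n"
        using mn by (auto simp: monomials_def)
      then show ?thesis by (simp add: in_keys_iff)
    qed
  qed
  then show thesis
    by (intro that[of ?\<mu>]) (simp_all add: feature_mono_add)
qed

section \<open>Monomial orders from positive weights\<close>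

section \<open>Weight orders\<close>

definition weight :: "('v \<Rightarrow> nat) \<Rightarrow> 'v mono \<Rightarrow> nat" where
  "weight w m = (\<Sum>v\<in>Poly_Mapping.keys m. Poly_Mapping.lookup m v * w v)"

lemma weight_superset:
  assumes "finite S" "Poly_Mapping.keys m \<subseteq> S"
  shows "weight w m = (\<Sum>v\<in>S. Poly_Mapping.lookup m v * w v)"
  unfolding weight_def using assms by (intro sum.mono_neutral_left) (auto simp: in_keys_iff)

lemma weight_add: "weight w (m + n) = weight w m + weight w n"
proof -
  let ?S = "Poly_Mapping.keys m \<union> Poly_Mapping.keys n"
  have "weight w (m + n) = (\<Sum>v\<in>?S. Poly_Mapping.lookup (m + n) v * w v)"
    by (rule weight_superset) (use keys_add[of m n] in auto)
  also have "\<dots> = weight w m + weight w n"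
    by (simp add: lookup_add distrib_right sum.distrib weight_superset[of ?S])
  finally show ?thesis .
qed

lemma weight_single: "weight w (Poly_Mapping.single v c) = c * w v"
  by (simp add: weight_def)

text \<open>Each weight is at least 1, so every exponent is bounded by the weight of
  \<open>m\<close>. Finite weight levels will make the order well-founded.\<close>

lemma finite_weight_le:
  assumes "finite X" and pos: "\<And>v. v \<in> X \<Longrightarrow> w v > 0"
  shows "finite {m \<in> monomials X. weight w m \<le> k}"
proof (rule finite_imageD[of Poly_Mapping.lookup])
  have "Poly_Mapping.lookup m v \<in> {..k}"
    if "m \<in> monomials X" "weight w m \<le> k" for m v
  proof (cases "v \<in> Poly_Mapping.keys m")
    case True
    then have "Poly_Mapping.lookup m v * 1 \<le> Poly_Mapping.lookup m v * w v"
      using that pos[of v] by (intro mult_le_mono2) (auto simp: monomials_def)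
    also have "\<dots> \<le> weight w m"
      unfolding weight_def using True by (intro member_le_sum) auto
    finally show ?thesis using that by simp
  qed (simp add: in_keys_iff)
  moreover have "Poly_Mapping.lookup m v = 0" if "m \<in> monomials X" "v \<notin> X" for m v
    using that unfolding monomials_def not_in_keys_iff_lookup_eq_zero[symmetric] by blast
  ultimately have "Poly_Mapping.lookup ` {m \<in> monomials X. weight w m \<le> k} \<subseteq>
      {f. \<forall>v. (v \<in> X \<longrightarrow> f v \<in> {..k}) \<and> (v \<notin> X \<longrightarrow> f v = 0)}"
    by (intro image_subsetI CollectI allI conjI impI) simp_all
  then show "finite (Poly_Mapping.lookup ` {m \<in> monomials X. weight w m \<le> k})"
    by (rule finite_subset[OF _ finite_set_of_finite_funs[OF assms(1) finite_atMost]])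
  show "inj_on Poly_Mapping.lookup {m \<in> monomials X. weight w m \<le> k}"
    by (rule inj_onI) (simp only: poly_mapping_eq_iff)
qed

lemma add_in_monomials: "m \<in> monomials X \<Longrightarrow> n \<in> monomials X \<Longrightarrow> m + n \<in> monomials X"
  using keys_add[of m n] by (auto simp: monomials_def)

text \<open>Equal weights are compared through an injective additive encoding into
  \<open>nat mono\<close>, whose linear order is compatible with addition.\<close>

lemma monomial_order_refining_weight:
  assumes "finite X" and pos: "\<And>v. v \<in> X \<Longrightarrow> w v > 0"
  obtains r where "monomial_order X r"
    "\<And>m n. m \<in> monomials X \<Longrightarrow> n \<in> monomials X \<Longrightarrow> weight w m < weight w n \<Longrightarrow> (m, n) \<in> r"
proof -
  obtain \<mu> :: "'a mono \<Rightarrow> nat mono" where \<mu>: "\<And>m n. \<mu> (m + n) = \<mu> m + \<mu> n" "inj_on \<mu> (monomials X)"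
    using mono_encoding[OF assms(1)] by metis
  define r where "r = {(m, n). m \<in> monomials X \<and> n \<in> monomials X \<and>
    (weight w m < weight w n \<or> weight w m = weight w n \<and> \<mu> m \<le> \<mu> n)}"
  have lin: "linear_order_on (monomials X) r"
    unfolding linear_order_on_def partial_order_on_def preorder_on_def
  proof (intro conjI)
    show "antisym r"
    proof (rule antisymI)
      fix m n assume "(m, n) \<in> r" "(n, m) \<in> r"
      then have "m \<in> monomials X" "n \<in> monomials X" "\<mu> m = \<mu> n"
        by (auto simp: r_def)
      then show "m = n" using \<mu>(2) by (simp add: inj_on_eq_iff)
    qed
    show "total_on (monomials X) r"
      unfolding total_on_def r_def using nat_neq_iff linear by auto
  qed (auto simp: refl_on_def trans_def r_def)
  have "wf (r - Id)"
  proof (rule wfI_min)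
    fix m and Q :: "'a mono set"
    assume "m \<in> Q"
    show "\<exists>z\<in>Q. \<forall>y. (y, z) \<in> r - Id \<longrightarrow> y \<notin> Q"
    proof (cases "m \<in> monomials X")
      case False
      then show ?thesis using \<open>m \<in> Q\<close> by (auto simp: r_def)
    next
      case True
      \<comment> \<open>A least element is found in two stages: the smallest weight that occurs,
        then the smallest encoding within this finite level.\<close>
      define k where "k = (LEAST k. \<exists>n\<in>Q \<inter> monomials X. weight w n = k)"
      define M where "M = {n \<in> Q \<inter> monomials X. weight w n = k}"
      have "\<exists>n\<in>Q \<inter> monomials X. weight w n = k"
        unfolding k_def by (rule LeastI_ex) (use True \<open>m \<in> Q\<close> in blast)
      then have "M \<noteq> {}" by (auto simp: M_def)
      moreover have "finite M"
        by (rule finite_subset[OF _ finite_weight_le[OF assms, where k = k]]) (auto simp: M_def)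
      ultimately have "Min (\<mu> ` M) \<in> \<mu> ` M" "\<forall>n\<in>M. Min (\<mu> ` M) \<le> \<mu> n"
        by (auto intro!: Min_in)
      then obtain z where z: "z \<in> M" "\<forall>n\<in>M. \<mu> z \<le> \<mu> n"
        by auto
      have "y \<notin> Q" if "(y, z) \<in> r - Id" for y
      proof
        assume "y \<in> Q"
        with that have y: "y \<in> Q \<inter> monomials X" by (simp add: r_def)
        then have "k \<le> weight w y" unfolding k_def by (intro Least_le) blast
        with that z(1) y have "y \<in> M" "\<mu> y \<le> \<mu> z" by (auto simp: r_def M_def)
        with z have "\<mu> y = \<mu> z" by (simp add: order.antisym)
        then have "y = z" using y z(1) \<mu>(2) by (simp add: M_def inj_on_eq_iff)
        then show False using that by simp
      qed
      then show ?thesis using z(1) by (auto simp: M_def)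
    qed
  qed
  moreover have "(m + k, n + k) \<in> r" if "k \<in> monomials X" "(m, n) \<in> r" for m n k
    using that by (auto simp: r_def weight_add \<mu>(1) add_in_monomials)
  ultimately have "monomial_order X r"
    using lin unfolding monomial_order_def well_order_on_def by blast
  then show thesis
    by (rule that) (simp add: r_def)
qed

section \<open>Polynomials vanishing at all positive points\<close>

section \<open>Linear independence of monomial functions\<close>

definition mono_eval :: "('w \<Rightarrow> real) \<Rightarrow> 'w mono \<Rightarrow> real" where
  "mono_eval \<theta> m = (\<Prod>v\<in>Poly_Mapping.keys m. \<theta> v ^ Poly_Mapping.lookup m v)"

lemma mono_eval_superset:
  assumes "finite S" "Poly_Mapping.keys m \<subseteq> S"
  shows "mono_eval \<theta> m = (\<Prod>v\<in>S. \<theta> v ^ Poly_Mapping.lookup m v)"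
  unfolding mono_eval_def using assms
  by (intro prod.mono_neutral_left) (auto simp: in_keys_iff)

lemma mono_eval_add: "mono_eval \<theta> (m + n) = mono_eval \<theta> m * mono_eval \<theta> n"
proof -
  let ?S = "Poly_Mapping.keys m \<union> Poly_Mapping.keys n"
  have "mono_eval \<theta> (m + n) = (\<Prod>v\<in>?S. \<theta> v ^ Poly_Mapping.lookup (m + n) v)"
    by (rule mono_eval_superset) (use keys_add[of m n] in auto)
  also have "\<dots> = mono_eval \<theta> m * mono_eval \<theta> n"
    by (simp add: lookup_add power_add prod.distrib mono_eval_superset[of ?S])
  finally show ?thesis .
qed

lemma mono_eval_zero [simp]: "mono_eval \<theta> 0 = 1"
  by (simp add: mono_eval_def)

lemma mono_eval_single: "mono_eval \<theta> (Poly_Mapping.single v c) = \<theta> v ^ c"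
  by (simp add: mono_eval_def)

lemma mono_eval_sum: "mono_eval \<theta> (\<Sum>a\<in>B. F a) = (\<Prod>a\<in>B. mono_eval \<theta> (F a))"
  by (induction B rule: infinite_finite_induct) (simp_all add: mono_eval_add)

lemma alg_hom_mono_eval: "alg_hom id (mono_eval \<theta>)"
  by unfold_locales (simp_all add: mono_eval_add)

text \<open>If the exponents of \<open>u\<close> differ, the point with value 2 at \<open>u\<close>
  and 1 elsewhere separates the monomials.\<close>

lemma mono_eval_separates:
  assumes "m \<noteq> n"
  obtains \<theta> where "\<forall>v. \<theta> v > 0" "mono_eval \<theta> m \<noteq> mono_eval \<theta> n"
proof -
  obtain u where u: "Poly_Mapping.lookup m u \<noteq> Poly_Mapping.lookup n u"
    using assms by (metis poly_mapping_eqI)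
  have "mono_eval (\<lambda>v. if v = u then 2 else 1) k = 2 ^ Poly_Mapping.lookup k u" for k
    by (simp add: mono_eval_def if_distrib[of "\<lambda>x. x ^ _"] prod.delta in_keys_iff cong: if_cong)
  then show thesis
    using u by (intro that[of "\<lambda>v. if v = u then 2 else 1"]) auto
qed

text \<open>Artin's argument for the independence of characters.\<close>

lemma mono_eval_independent:
  assumes "finite M" and "\<And>\<theta>. (\<And>v. \<theta> v > 0) \<Longrightarrow> (\<Sum>m\<in>M. c m * mono_eval \<theta> m) = 0" and "m \<in> M"
  shows "c m = 0"
  using assms
proof (induction M arbitrary: c m rule: finite_induct)
  case (insert m0 M)
  have M: "c n = 0" if "n \<in> M" for n
  proof -
    have "n \<noteq> m0" using that insert.hyps by auto
    then obtain \<eta> where \<eta>: "\<forall>v. \<eta> v > 0" "mono_eval \<eta> n \<noteq> mono_eval \<eta> m0"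
      by (rule mono_eval_separates)
    \<comment> \<open>Multiplying the points by \<open>\<eta>\<close> scales each monomial by its
      value at \<open>\<eta>\<close>. Subtracting \<open>mono_eval \<eta> m0\<close> times the
      original relation cancels \<open>m0\<close> and leaves a relation over
      \<open>M\<close>.\<close>
    have "c n * (mono_eval \<eta> n - mono_eval \<eta> m0) = 0"
    proof (rule insert.IH[OF _ that])
      fix \<theta> :: "'a \<Rightarrow> real" assume \<theta>: "\<And>v. \<theta> v > 0"
      have "mono_eval (\<lambda>v. \<eta> v * \<theta> v) k = mono_eval \<eta> k * mono_eval \<theta> k" for k
        by (simp add: mono_eval_def power_mult_distrib prod.distrib)
      moreover have "(\<Sum>m\<in>insert m0 M. c m * mono_eval (\<lambda>v. \<eta> v * \<theta> v) m) = 0"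
        by (rule insert.prems(1)) (simp add: \<eta>(1) \<theta>)
      moreover have "(\<Sum>m\<in>insert m0 M. c m * mono_eval \<theta> m) = 0"
        by (rule insert.prems(1)) (rule \<theta>)
      ultimately have
        "(\<Sum>m\<in>M. c m * (mono_eval \<eta> m * mono_eval \<theta> m)) + c m0 * (mono_eval \<eta> m0 * mono_eval \<theta> m0) = 0"
        "mono_eval \<eta> m0 * (\<Sum>m\<in>M. c m * mono_eval \<theta> m) + mono_eval \<eta> m0 * (c m0 * mono_eval \<theta> m0) = 0"
        using insert.hyps by (simp_all add: add.commute flip: distrib_left)
      then show "(\<Sum>k\<in>M. c k * (mono_eval \<eta> k - mono_eval \<eta> m0) * mono_eval \<theta> k) = 0"
        by (simp add: algebra_simps sum_subtractf sum_distrib_left)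
    qed
    then show ?thesis using \<eta>(2) by simp
  qed
  have "(\<Sum>m\<in>insert m0 M. c m * mono_eval (\<lambda>_. 1) m) = 0"
    by (rule insert.prems(1)) simp
  then have "c m0 = 0"
    using insert.hyps M by (simp add: mono_eval_def)
  then show ?case using M insert.prems(2) by auto
qed simp

lemma mono_eval_feature_mono:
  "mono_eval \<theta> (feature_mono feat p m) =
    (\<Prod>v\<in>Poly_Mapping.keys m. (\<Prod>t\<le>p. \<theta> (feat t v)) ^ Poly_Mapping.lookup m v)"
  by (simp add: feature_mono_def mono_eval_sum mono_eval_single prod_power_distrib)

section \<open>Ideals and initial monomials\<close>

section \<open>Ideals and initial monomials\<close>

abbreviation unit_mono :: "'v \<Rightarrow> 'v mono" where
  "unit_mono v \<equiv> Poly_Mapping.single v 1"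

lemma minus_unit_mono_add:
  "a \<in> Poly_Mapping.keys m \<Longrightarrow> unit_mono a + (m - unit_mono a) = (m :: 'v mono)"
  by (rule poly_mapping_eqI) (auto simp: lookup_add lookup_minus lookup_single when_def in_keys_iff)

lemma keys_minus_unit_mono: "Poly_Mapping.keys (m - unit_mono a) \<subseteq> Poly_Mapping.keys (m :: 'v mono)"
  by (auto simp: in_keys_iff lookup_minus)

lemma mono_poly_in_carrier [simp]:
  "Poly_Mapping.keys (mono_poly m) \<subseteq> monomials X \<longleftrightarrow> m \<in> monomials X"
  by (simp add: mono_poly_def)

lemma unit_mono_in_monomials: "v \<in> X \<Longrightarrow> unit_mono v \<in> monomials X"
  by (simp add: monomials_def)

lemma poly_ideal_closed:
  assumes "ideal I (poly_ring X)"
  shows poly_ideal_zero: "0 \<in> I"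
    and poly_ideal_add: "f \<in> I \<Longrightarrow> g \<in> I \<Longrightarrow> f + g \<in> I"
    and poly_ideal_mult: "f \<in> I \<Longrightarrow> g \<in> carrier (poly_ring X) \<Longrightarrow> g * f \<in> I"
  using additive_subgroup.zero_closed[OF ideal.axioms(1)[OF assms]]
    additive_subgroup.a_closed[OF ideal.axioms(1)[OF assms]] ideal.I_l_closed[OF assms]
  by simp_all

lemma poly_ideal_sum:
  assumes "ideal I (poly_ring X)" "\<And>a. a \<in> B \<Longrightarrow> F a \<in> I"
  shows "(\<Sum>a\<in>B. F a) \<in> I"
  using assms(2)
  by (induction B rule: infinite_finite_induct)
    (simp_all add: poly_ideal_zero[OF assms(1)] poly_ideal_add[OF assms(1)])

lemma linear_order_on_finite_max:
  assumes "finite K" "K \<noteq> {}" "K \<subseteq> S" "linear_order_on S r"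
  shows "\<exists>m\<in>K. \<forall>n\<in>K. (n, m) \<in> r"
  using assms(1-3)
proof (induction K rule: finite_ne_induct)
  case (singleton m)
  then show ?case using assms(4)
    by (auto simp: linear_order_on_def partial_order_on_def preorder_on_def refl_on_def)
next
  case (insert m K)
  then obtain k where k: "k \<in> K" "\<forall>n\<in>K. (n, k) \<in> r" by auto
  have r: "(m, m) \<in> r" "trans r" "total_on S r"
    using assms(4) insert.prems by (auto simp: linear_order_on_def partial_order_on_def preorder_on_def refl_on_def)
  have "(m, k) \<in> r \<or> (k, m) \<in> r"
    using r k insert by (auto simp: total_on_def)
  then show ?case
  proof
    assume "(k, m) \<in> r"
    then have "\<forall>n\<in>insert m K. (n, m) \<in> r" using k(2) r(1,2) by (auto dest: transD)
    then show ?thesis by blast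
  qed (use k in blast)
qed

lemma initial_mono_eqI:
  assumes "antisym r" "m \<in> Poly_Mapping.keys f" "\<And>n. n \<in> Poly_Mapping.keys f \<Longrightarrow> (n, m) \<in> r"
  shows "initial_mono r f = m"
  unfolding initial_mono_def using assms by (intro the_equality) (auto dest: antisymD)

lemma initial_mono_max:
  assumes "linear_order_on (monomials X) r" "f \<in> carrier (poly_ring X)" "f \<noteq> 0"
  shows "initial_mono r f \<in> Poly_Mapping.keys f"
    and "n \<in> Poly_Mapping.keys f \<Longrightarrow> (n, initial_mono r f) \<in> r"
proof -
  obtain m where m: "m \<in> Poly_Mapping.keys f" "\<forall>n\<in>Poly_Mapping.keys f. (n, m) \<in> r"
    using linear_order_on_finite_max[OF finite_keys _ _ assms(1), of f] assms(2,3) by auto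
  moreover have "antisym r"
    using assms(1) by (simp add: linear_order_on_def partial_order_on_def)
  ultimately have "initial_mono r f = m" by (intro initial_mono_eqI) auto
  then show "initial_mono r f \<in> Poly_Mapping.keys f"
    and "n \<in> Poly_Mapping.keys f \<Longrightarrow> (n, initial_mono r f) \<in> r"
    using m by auto
qed

lemma keys_binomial:
  "m \<noteq> n \<Longrightarrow> Poly_Mapping.keys (mono_poly m - mono_poly n) = {m, n}"
  by (auto simp: mono_poly_def in_keys_iff lookup_minus lookup_single when_def split: if_splits)

lemma poly_ring_diff_closed:
  "f \<in> carrier (poly_ring X) \<Longrightarrow> g \<in> carrier (poly_ring X) \<Longrightarrow> f - g \<in> carrier (poly_ring X)"
proof -
  have "Poly_Mapping.keys (f - g) \<subseteq> Poly_Mapping.keys f \<union> Poly_Mapping.keys g"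
    by (auto simp: in_keys_iff lookup_minus)
  then show "f \<in> carrier (poly_ring X) \<Longrightarrow> g \<in> carrier (poly_ring X) \<Longrightarrow> f - g \<in> carrier (poly_ring X)"
    by auto
qed

section \<open>Groebner bases from a swap property\<close>

section \<open>Toric ideals with a swap property\<close>

text \<open>A variable \<open>a\<close> is described by its coordinates \<open>co t a\<close>; its \<open>t\<close>-th feature records the
  coordinate together with a context \<open>cx t a\<close> that depends on the earlier coordinates only.\<close>

locale feature_system =
  fixes X :: "'v set" and p :: nat and co :: "nat \<Rightarrow> 'v \<Rightarrow> nat" and cx :: "nat \<Rightarrow> 'v \<Rightarrow> 'c"
    and feat :: "nat \<Rightarrow> 'v \<Rightarrow> 'w"
  assumes finite_X: "finite X"
    and feat_eq: "\<lbrakk>a \<in> X; b \<in> X; s \<le> p; t \<le> p\<rbrakk> \<Longrightarrow>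
      feat s a = feat t b \<longleftrightarrow> s = t \<and> cx s a = cx t b \<and> co s a = co t b"
    and co_ext: "\<lbrakk>a \<in> X; b \<in> X; \<And>t. t \<le> p \<Longrightarrow> co t a = co t b\<rbrakk> \<Longrightarrow> a = b"
    and cx_prefix: "\<lbrakk>a \<in> X; b \<in> X; t \<le> p; \<And>s. s < t \<Longrightarrow> co s a = co s b\<rbrakk> \<Longrightarrow> cx t a = cx t b"
    and swap: "\<lbrakk>a \<in> X; b \<in> X; 0 < t; t \<le> p; cx t a = cx t b\<rbrakk> \<Longrightarrow>
      \<exists>a'\<in>X. \<exists>b'\<in>X.
        feature_mono feat p (unit_mono a' + unit_mono b') = feature_mono feat p (unit_mono a + unit_mono b) \<and>
        (\<forall>s<t. co s a' = co s a \<and> co s b' = co s b) \<and> co t a' = co t b \<and> co t b' = co t a \<and>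
        (\<forall>s\<le>p. co s a' + co s b' = co s a + co s b)"
begin

abbreviation \<Phi> :: "'v mono \<Rightarrow> 'w mono" where
  "\<Phi> \<equiv> feature_mono feat p"

subsection \<open>A weight that drops when a conflict is removed\<close>

text \<open>Larger than every coordinate, so that coordinates are digits in this base;
  \<open>code\<close> reads them with coordinate 0 most significant.\<close>

definition base :: nat where
  "base = Suc (\<Sum>a\<in>X. \<Sum>s\<le>p. co s a)"

lemma co_less_base: "a \<in> X \<Longrightarrow> s \<le> p \<Longrightarrow> co s a < base"
  unfolding base_def less_Suc_eq_le
  by (rule order_trans[OF member_le_sum[of s "{..p}" "\<lambda>s. co s a"] member_le_sum[of a X "\<lambda>a. \<Sum>s\<le>p. co s a"]])
    (simp_all add: finite_X)

primrec code :: "nat \<Rightarrow> 'v \<Rightarrow> nat" where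
  "code 0 a = co 0 a"
| "code (Suc t) a = code t a * base + co (Suc t) a"

lemma code_cong: "(\<And>s. s \<le> t \<Longrightarrow> co s a = co s b) \<Longrightarrow> code t a = code t b"
  by (induction t) auto

lemma code_sum_cong:
  "(\<And>s. s \<le> t \<Longrightarrow> co s a' + co s b' = co s a + co s b) \<Longrightarrow> code t a' + code t b' = code t a + code t b"
proof (induction t)
  case (Suc t)
  then have "(code t a' + code t b') * base = (code t a + code t b) * base" by simp
  moreover have "co (Suc t) a' + co (Suc t) b' = co (Suc t) a + co (Suc t) b"
    by (rule Suc.prems) simp
  ultimately show ?case by (simp add: distrib_right)
qed simp

text \<open>At the first difference \<open>b\<close> gains at least one unit, and every later digit
  of \<open>a\<close> is below \<open>base\<close>, too small to make it up.\<close>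

lemma code_less:
  assumes "a \<in> X" "b \<in> X" "i \<le> t" "t \<le> p" "\<And>s. s < i \<Longrightarrow> co s a = co s b" "co i a < co i b"
  shows "code t a < code t b"
  using assms(3,4)
proof (induction t)
  case 0
  then show ?case using assms(6) by simp
next
  case (Suc t)
  show ?case
  proof (cases "i = Suc t")
    case True
    then have "code t a = code t b" by (intro code_cong assms(5)) simp
    then show ?thesis using True assms(6) by simp
  next
    case False
    then have "Suc (code t a) * base \<le> code t b * base"
      using Suc by (intro mult_le_mono1) simp
    then show ?thesis using co_less_base[OF assms(1) Suc.prems(2)] by simp
  qed
qed

lemma least_difference:
  assumes "co s a \<noteq> co s b"
  obtains i where "i \<le> s" "\<And>t. t < i \<Longrightarrow> co t a = co t b" "co i a \<noteq> co i b"
proof (rule that[of "LEAST i. co i a \<noteq> co i b"])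
  show "(LEAST i. co i a \<noteq> co i b) \<le> s" using assms by (rule Least_le)
  show "co (LEAST i. co i a \<noteq> co i b) a \<noteq> co (LEAST i. co i a \<noteq> co i b) b"
    using assms by (rule LeastI)
qed (use not_less_Least in blast)

text \<open>Swapping spreads the codes of two variables while preserving their sum, so a strictly
  concave function of the code decreases.\<close>

definition var_weight :: "'v \<Rightarrow> nat" where
  "var_weight a = Suc (\<Sum>b\<in>X. (code p b)\<^sup>2) - (code p a)\<^sup>2"

lemma var_weight: "a \<in> X \<Longrightarrow> var_weight a + (code p a)\<^sup>2 = Suc (\<Sum>b\<in>X. (code p b)\<^sup>2) \<and> 0 < var_weight a"
  using member_le_sum[of a X "\<lambda>b. (code p b)\<^sup>2"] finite_X by (simp add: var_weight_def)

abbreviation wt :: "'v mono \<Rightarrow> nat" where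
  "wt \<equiv> weight var_weight"

text \<open>The first difference \<open>i\<close> puts \<open>a\<close> below \<open>b\<close>,
  while at \<open>j\<close> a swap in a common context would push them further apart.\<close>

definition conflict :: "'v \<Rightarrow> 'v \<Rightarrow> bool" where
  "conflict a b \<longleftrightarrow> (\<exists>i j. i < j \<and> j \<le> p \<and> (\<forall>s<i. co s a = co s b) \<and> co i a < co i b \<and>
     cx j a = cx j b \<and> co j b < co j a)"

lemma conflict_reducible:
  assumes "a \<in> X" "b \<in> X" "conflict a b"
  obtains a' b' where "a' \<in> X" "b' \<in> X" "\<Phi> (unit_mono a' + unit_mono b') = \<Phi> (unit_mono a + unit_mono b)"
    "wt (unit_mono a' + unit_mono b') < wt (unit_mono a + unit_mono b)"
proof -
  obtain i j where ij: "i < j" "j \<le> p" "\<forall>s<i. co s a = co s b" "co i a < co i b"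
    "cx j a = cx j b" "co j b < co j a"
    using assms(3) by (auto simp: conflict_def)
  obtain a' b' where ab': "a' \<in> X" "b' \<in> X"
    "\<Phi> (unit_mono a' + unit_mono b') = \<Phi> (unit_mono a + unit_mono b)"
    "\<forall>s<j. co s a' = co s a \<and> co s b' = co s b" "co j a' = co j b" "co j b' = co j a"
    "\<forall>s\<le>p. co s a' + co s b' = co s a + co s b"
    using swap[OF assms(1,2) _ ij(2,5)] ij(1) by auto
  have "code p a' < code p a"
    by (rule code_less[of _ _ j]) (use assms ij ab' in auto)
  then obtain k where k: "code p a = code p a' + k" "k > 0"
    using less_imp_add_positive by metis
  have "code p a < code p b"
    by (rule code_less[of _ _ i]) (use assms ij in auto)
  then have less: "code p a' < code p b" using k by simp
  have "code p a' + code p b' = code p a + code p b"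
    by (rule code_sum_cong) (use ab'(7) in blast)
  with k have b': "code p b' = code p b + k" by simp
  \<comment> \<open>With \<open>k\<close> units moved from the smaller to the larger code, the sum
    of squares grows by \<open>2 k (code p b - code p a')\<close>, so the weight drops by this
    amount.\<close>
  have "(code p a)\<^sup>2 + (code p b)\<^sup>2 < (code p a')\<^sup>2 + (code p b')\<^sup>2"
    unfolding k(1) b' power2_sum using mult_strict_left_mono[OF less k(2)] by (simp add: mult.commute)
  then have "var_weight a' + var_weight b' < var_weight a + var_weight b"
    using var_weight[OF assms(1)] var_weight[OF assms(2)] var_weight[OF ab'(1)] var_weight[OF ab'(2)]
    by linarith
  then show thesis
    by (intro that[OF ab'(1-3)]) (simp add: weight_add weight_single)
qed

subsection \<open>Uniqueness of conflict-free monomials\<close>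

text \<open>These serve as normal forms modulo the quadrics. No variable conflicts with itself, so
  powers of a variable are allowed.\<close>

definition standard :: "'v mono \<Rightarrow> bool" where
  "standard m \<longleftrightarrow> m \<in> monomials X \<and> (\<forall>a\<in>Poly_Mapping.keys m. \<forall>b\<in>Poly_Mapping.keys m. \<not> conflict a b)"

text \<open>Among the variables of \<open>n\<close> take \<open>b\<close> with the longest common prefix with the least variable
  \<open>a\<close>. If they differed at \<open>j\<close>, then a variable of \<open>n\<close> sharing the \<open>j\<close>-th feature of \<open>a\<close>
  would be in conflict with \<open>b\<close>.\<close>

lemma least_variable_common:
  assumes m: "m \<in> monomials X" and n: "standard n" and \<Phi>: "\<Phi> m = \<Phi> n" and a: "a \<in> Poly_Mapping.keys m"
    and least: "\<And>b. b \<in> Poly_Mapping.keys n \<Longrightarrow> code p a \<le> code p b"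
  shows "a \<in> Poly_Mapping.keys n"
proof -
  have aX: "a \<in> X" using m a by (auto simp: monomials_def)
  have nX: "b \<in> X" if "b \<in> Poly_Mapping.keys n" for b
    using n that by (auto simp: standard_def monomials_def)
  have share: "\<exists>b\<in>Poly_Mapping.keys n. cx t b = cx t a \<and> co t b = co t a" if t: "t \<le> p" for t
  proof -
    have "feat t a \<in> Poly_Mapping.keys (\<Phi> n)"
      unfolding \<Phi>[symmetric] in_keys_feature_mono using a t by blast
    then obtain b s where "b \<in> Poly_Mapping.keys n" "s \<le> p" "feat s b = feat t a"
      unfolding in_keys_feature_mono by blast
    then show ?thesis using feat_eq[OF nX aX] t by blast
  qed
  have less: "co i a < co i b"
    if "b \<in> Poly_Mapping.keys n" "i \<le> p" "\<And>s. s < i \<Longrightarrow> co s a = co s b" "co i a \<noteq> co i b" for b i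
  proof (rule ccontr)
    assume "\<not> co i a < co i b"
    then have "code p b < code p a"
      using that by (intro code_less[of _ _ i]) (auto simp: nX aX)
    then show False using least[OF that(1)] by simp
  qed
  define agree where "agree b j \<longleftrightarrow> b \<in> Poly_Mapping.keys n \<and> (\<forall>s<j. co s a = co s b)" for b j
  \<comment> \<open>The longest agreement with \<open>a\<close> reached in \<open>n\<close>; the
    value \<open>Suc p\<close> means agreement on all coordinates \<open>0..p\<close>, hence
    equality with \<open>a\<close>.\<close>
  define j where "j = (GREATEST j. j \<le> Suc p \<and> (\<exists>b. agree b j))"
  have ex: "0 \<le> Suc p \<and> (\<exists>b. agree b 0)" using share[of 0] by (auto simp: agree_def)
  have j: "j \<le> Suc p \<and> (\<exists>b. agree b j)"
    unfolding j_def by (rule GreatestI_nat[where b = "Suc p"]) (use ex in auto)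
  then obtain b where b: "agree b j" by blast
  show ?thesis
  proof (cases "j = Suc p")
    case True
    then have "a = b" using b by (intro co_ext aX nX) (auto simp: agree_def)
    then show ?thesis using b by (simp add: agree_def)
  next
    case False
    then have jp: "j \<le> p" using j by simp
    have maximal: "\<not> agree c (Suc j)" for c
    proof
      assume "agree c (Suc j)"
      then have "Suc j \<le> j"
        unfolding j_def using jp by (intro Greatest_le_nat[where b = "Suc p"]) (auto simp: j_def)
      then show False by simp
    qed
    have "co j a \<noteq> co j b" using maximal[of b] b by (auto simp: agree_def less_Suc_eq)
    with b jp have jless: "co j a < co j b" by (intro less) (auto simp: agree_def)
    obtain b' where b': "b' \<in> Poly_Mapping.keys n" "cx j b' = cx j a" "co j b' = co j a"
      using share[OF jp] by blast
    then obtain s where s: "s < j" "co s a \<noteq> co s b'"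
      using maximal[of b'] by (auto simp: agree_def less_Suc_eq)
    obtain i where i: "i \<le> s" "\<And>t. t < i \<Longrightarrow> co t a = co t b'" "co i a \<noteq> co i b'"
      by (rule least_difference[OF s(2)]) blast
    have "co i a < co i b'" using less[OF b'(1) _ i(2,3)] i(1) s(1) jp by simp
    moreover have "cx j a = cx j b"
      using b jp by (intro cx_prefix aX nX) (auto simp: agree_def)
    \<comment> \<open>\<open>b\<close> agrees with \<open>a\<close> below \<open>j\<close> and
      \<open>i < j\<close>, so \<open>b\<close> lies below \<open>b'\<close> at \<open>i\<close>; at
      \<open>j\<close> it exceeds \<open>b'\<close>, which has the value of \<open>a\<close>
      there.\<close>
    ultimately have "conflict b b'"
      unfolding conflict_def using b b' i s jp jless
      by (intro exI[of _ i] exI[of _ j]) (auto simp: agree_def)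
    then show ?thesis using n b b' by (auto simp: standard_def agree_def)
  qed
qed

lemma standard_divisor:
  "standard m \<Longrightarrow> Poly_Mapping.keys k \<subseteq> Poly_Mapping.keys m \<Longrightarrow> standard k"
  unfolding standard_def monomials_def by blast

text \<open>Induction on the degree, written as the weight with all weights 1: the variable of least
  code in \<open>m\<close> and \<open>n\<close> together occurs in both, and cancelling it leaves
  standard monomials with equal images.\<close>

lemma standard_unique:
  assumes "standard m" "standard n" "\<Phi> m = \<Phi> n"
  shows "m = n"
  using assms
proof (induction "weight (\<lambda>_. 1) m" arbitrary: m n rule: less_induct)
  case less
  let ?K = "Poly_Mapping.keys m \<union> Poly_Mapping.keys n"
  show ?case
  proof (cases "?K = {}")
    case True
    then show ?thesis by (metis keys_eq_empty sup_eq_bot_iff)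
  next
    case False
    then obtain a where a: "a \<in> ?K" "\<And>b. b \<in> ?K \<Longrightarrow> code p a \<le> code p b"
      using arg_min_if_finite[of ?K "code p"] by (metis finite_Un finite_keys not_le)
    have am: "a \<in> Poly_Mapping.keys m" and an: "a \<in> Poly_Mapping.keys n"
      using a least_variable_common[of m n a] least_variable_common[of n m a] less.prems
      by (auto simp: standard_def)
    note split = minus_unit_mono_add[OF am] minus_unit_mono_add[OF an]
    have "m - unit_mono a = n - unit_mono a"
    proof (rule less.hyps)
      have "weight (\<lambda>_. 1) m = 1 + weight (\<lambda>_. 1) (m - unit_mono a)"
        by (subst split(1)[symmetric]) (simp only: weight_add weight_single)
      then show "weight (\<lambda>_. 1) (m - unit_mono a) < weight (\<lambda>_. 1) m" by simp
      have "\<Phi> (unit_mono a) + \<Phi> (m - unit_mono a) = \<Phi> (unit_mono a) + \<Phi> (n - unit_mono a)"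
        unfolding feature_mono_add[symmetric] split by (rule less.prems(3))
      then show "\<Phi> (m - unit_mono a) = \<Phi> (n - unit_mono a)" by simp
    qed (rule standard_divisor[OF _ keys_minus_unit_mono], fact)+
    then show ?thesis using split by metis
  qed
qed

subsection \<open>Reduction to standard monomials\<close>

definition quadrics :: "'v mpoly set" where
  "quadrics = {mono_poly (unit_mono a + unit_mono b) - mono_poly (unit_mono a' + unit_mono b') | a b a' b'.
     a \<in> X \<and> b \<in> X \<and> a' \<in> X \<and> b' \<in> X \<and> a \<noteq> b \<and>
     \<Phi> (unit_mono a' + unit_mono b') = \<Phi> (unit_mono a + unit_mono b) \<and>
     wt (unit_mono a' + unit_mono b') < wt (unit_mono a + unit_mono b)}"

sublocale toric: alg_hom "Poly_Mapping.single 0" "\<lambda>m. mono_poly (\<Phi> m)"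
  by (rule alg_hom_monomial_map) (simp_all add: feature_mono_add)

definition toric_kernel :: "'v mpoly set" where
  "toric_kernel = {f \<in> carrier (poly_ring X). toric.ext f = 0}"

lemma toric_ext_eq_0_iff:
  "toric.ext f = 0 \<longleftrightarrow>
    (\<forall>m\<in>Poly_Mapping.keys f. (\<Sum>n\<in>{n \<in> Poly_Mapping.keys f. \<Phi> n = \<Phi> m}. Poly_Mapping.lookup f n) = 0)"
  unfolding toric.ext_def by (rule monomial_map_kernel)

lemma pair_in_monomials: "a \<in> X \<Longrightarrow> b \<in> X \<Longrightarrow> unit_mono a + unit_mono b \<in> monomials X"
  by (intro add_in_monomials unit_mono_in_monomials)

lemma quadrics_subset_kernel: "quadrics \<subseteq> toric_kernel"
proof
  fix g assume "g \<in> quadrics"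
  then obtain u v where g: "g = mono_poly u - mono_poly v" "u \<in> monomials X" "v \<in> monomials X"
    "\<Phi> v = \<Phi> u" "wt v < wt u"
    unfolding quadrics_def by (auto simp only: mem_Collect_eq intro: pair_in_monomials)
  then have "u \<noteq> v" by auto
  then show "g \<in> toric_kernel"
    using g by (simp add: toric_kernel_def toric.ext_diff keys_binomial)
qed

lemma quadrics_subset_carrier: "quadrics \<subseteq> carrier (poly_ring X)"
  using quadrics_subset_kernel by (auto simp: toric_kernel_def)

lemma ideal_Idl_quadrics: "ideal (Idl\<^bsub>poly_ring X\<^esub> quadrics) (poly_ring X)"
  by (rule ring.genideal_ideal[OF cring.axioms(1)[OF cring_poly_ring] quadrics_subset_carrier])

lemma nonstandard_reducible:
  assumes "m \<in> monomials X" "\<not> standard m"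
  obtains a b a' b' k where "a \<in> X" "b \<in> X" "a' \<in> X" "b' \<in> X" "a \<noteq> b" "k \<in> monomials X"
    "m = (unit_mono a + unit_mono b) + k"
    "\<Phi> (unit_mono a' + unit_mono b') = \<Phi> (unit_mono a + unit_mono b)"
    "wt (unit_mono a' + unit_mono b') < wt (unit_mono a + unit_mono b)"
proof -
  obtain a b where ab: "a \<in> Poly_Mapping.keys m" "b \<in> Poly_Mapping.keys m" "conflict a b"
    using assms by (auto simp: standard_def)
  then have X: "a \<in> X" "b \<in> X" using assms(1) by (auto simp: monomials_def)
  \<comment> \<open>The strict inequality in a conflict rules out \<open>a = b\<close>; this makes
    the initial terms squarefree.\<close>
  have "a \<noteq> b" using ab(3) by (auto simp: conflict_def)
  then have b: "b \<in> Poly_Mapping.keys (m - unit_mono a)"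
    using ab(2) by (simp add: in_keys_iff lookup_minus lookup_single)
  let ?k = "m - unit_mono a - unit_mono b"
  have "m = (unit_mono a + unit_mono b) + ?k"
    using minus_unit_mono_add[OF ab(1)] minus_unit_mono_add[OF b] by (simp only: add.assoc)
  moreover have "?k \<in> monomials X"
    using assms(1) keys_minus_unit_mono[of m a] keys_minus_unit_mono[of "m - unit_mono a" b]
    unfolding monomials_def by blast
  moreover obtain a' b' where "a' \<in> X" "b' \<in> X"
    "\<Phi> (unit_mono a' + unit_mono b') = \<Phi> (unit_mono a + unit_mono b)"
    "wt (unit_mono a' + unit_mono b') < wt (unit_mono a + unit_mono b)"
    by (rule conflict_reducible[OF X ab(3)])
  ultimately show thesis using that X \<open>a \<noteq> b\<close> by blast
qed

text \<open>Induction on the weight: replacing a conflicting pair lowers it and changes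
  \<open>m\<close> by a multiple of a quadric. The weight clause serves to compare \<open>n\<close>
  with \<open>m\<close> in a monomial order.\<close>

lemma standard_form_exists:
  assumes "m \<in> monomials X"
  shows "\<exists>n. standard n \<and> \<Phi> n = \<Phi> m \<and> (n \<noteq> m \<longrightarrow> wt n < wt m) \<and>
    mono_poly m - mono_poly n \<in> Idl\<^bsub>poly_ring X\<^esub> quadrics"
  using assms
proof (induction "wt m" arbitrary: m rule: less_induct)
  case less
  interpret J: ideal "Idl\<^bsub>poly_ring X\<^esub> quadrics" "poly_ring X" by (rule ideal_Idl_quadrics)
  show ?case
  proof (cases "standard m")
    case True
    then show ?thesis using poly_ideal_zero[OF ideal_Idl_quadrics] by (intro exI[of _ m]) simp
  next
    case False
    then obtain a b a' b' k where red: "a \<in> X" "b \<in> X" "a' \<in> X" "b' \<in> X" "a \<noteq> b" "k \<in> monomials X"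
      "m = (unit_mono a + unit_mono b) + k"
      "\<Phi> (unit_mono a' + unit_mono b') = \<Phi> (unit_mono a + unit_mono b)"
      "wt (unit_mono a' + unit_mono b') < wt (unit_mono a + unit_mono b)"
      by (rule nonstandard_reducible[OF less.prems])
    let ?u = "unit_mono a + unit_mono b" and ?v = "unit_mono a' + unit_mono b'"
    have lt: "wt (?v + k) < wt m" unfolding red(7) using red(9) by (simp only: weight_add)
    have \<Phi>: "\<Phi> (?v + k) = \<Phi> m" unfolding red(7) using red(8) by (simp only: feature_mono_add)
    have "?v + k \<in> monomials X" using red by (intro add_in_monomials[of _ _ k] pair_in_monomials)
    from less.hyps[OF lt this] obtain n where n: "standard n" "\<Phi> n = \<Phi> (?v + k)"
      "n \<noteq> ?v + k \<longrightarrow> wt n < wt (?v + k)" "mono_poly (?v + k) - mono_poly n \<in> Idl\<^bsub>poly_ring X\<^esub> quadrics"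
      by blast
    have "mono_poly ?u - mono_poly ?v \<in> quadrics"
      unfolding quadrics_def using red by blast
    then have "mono_poly ?u - mono_poly ?v \<in> Idl\<^bsub>poly_ring X\<^esub> quadrics"
      using ring.genideal_self[OF cring.axioms(1)[OF cring_poly_ring] quadrics_subset_carrier] by blast
    moreover have "mono_poly k \<in> carrier (poly_ring X)" using red(6) by simp
    ultimately have "mono_poly k * (mono_poly ?u - mono_poly ?v) \<in> Idl\<^bsub>poly_ring X\<^esub> quadrics"
      by (rule poly_ideal_mult[OF ideal_Idl_quadrics])
    then have "mono_poly k * (mono_poly ?u - mono_poly ?v) + (mono_poly (?v + k) - mono_poly n) \<in> Idl\<^bsub>poly_ring X\<^esub> quadrics"
      using n(4) by (rule poly_ideal_add[OF ideal_Idl_quadrics])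
    also have "mono_poly k * (mono_poly ?u - mono_poly ?v) + (mono_poly (?v + k) - mono_poly n) = mono_poly m - mono_poly n"
      unfolding red(7) mono_poly_add by (simp only: algebra_simps)
    finally show ?thesis
      using n lt \<Phi> by (intro exI[of _ n]) auto
  qed
qed

text \<open>Modulo the quadrics each monomial may be replaced by its standard form, and a kernel
  element then collapses to 0.\<close>

lemma kernel_eq_Idl_quadrics: "toric_kernel = Idl\<^bsub>poly_ring X\<^esub> quadrics"
proof
  interpret J: ideal "Idl\<^bsub>poly_ring X\<^esub> quadrics" "poly_ring X" by (rule ideal_Idl_quadrics)
  show "Idl\<^bsub>poly_ring X\<^esub> quadrics \<subseteq> toric_kernel"
    using ring.genideal_minimal[OF cring.axioms(1)[OF cring_poly_ring] toric.ideal_ext_kernel[of X]] quadrics_subset_kernel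
    by (simp add: toric_kernel_def)
  show "toric_kernel \<subseteq> Idl\<^bsub>poly_ring X\<^esub> quadrics"
  proof
    fix f assume f: "f \<in> toric_kernel"
    define N where "N m = (SOME n. standard n \<and> \<Phi> n = \<Phi> m \<and> (n \<noteq> m \<longrightarrow> wt n < wt m) \<and>
      mono_poly m - mono_poly n \<in> Idl\<^bsub>poly_ring X\<^esub> quadrics)" for m
    have N: "standard (N m)" "\<Phi> (N m) = \<Phi> m" "mono_poly m - mono_poly (N m) \<in> Idl\<^bsub>poly_ring X\<^esub> quadrics"
      if "m \<in> Poly_Mapping.keys f" for m
    proof -
      have "m \<in> monomials X" using f that by (auto simp: toric_kernel_def)
      from someI_ex[OF standard_form_exists[OF this]] show "standard (N m)" "\<Phi> (N m) = \<Phi> m"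
        "mono_poly m - mono_poly (N m) \<in> Idl\<^bsub>poly_ring X\<^esub> quadrics"
        unfolding N_def by blast+
    qed
    have "N n = N m \<longleftrightarrow> \<Phi> n = \<Phi> m" if "n \<in> Poly_Mapping.keys f" "m \<in> Poly_Mapping.keys f" for m n
      using N(1,2)[OF that(1)] N(1,2)[OF that(2)] standard_unique by metis
    then have fibre: "{n \<in> Poly_Mapping.keys f. N n = N m} = {n \<in> Poly_Mapping.keys f. \<Phi> n = \<Phi> m}"
      if "m \<in> Poly_Mapping.keys f" for m
      using that by blast
    \<comment> \<open>Standard forms are equal exactly when the images are, so the coefficients
      collected at each standard form are a fibre sum, which vanishes for \<open>f\<close> in the
      kernel.\<close>
    have "(\<Sum>m\<in>Poly_Mapping.keys f. Poly_Mapping.single 0 (Poly_Mapping.lookup f m) * mono_poly (N m)) = 0"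
      unfolding monomial_map_kernel using f fibre by (simp add: toric_kernel_def toric_ext_eq_0_iff)
    moreover have "(\<Sum>m\<in>Poly_Mapping.keys f. Poly_Mapping.single 0 (Poly_Mapping.lookup f m) * mono_poly m) = f"
      by (subst (3) poly_mapping_sum_single) (simp add: mono_poly_def mult_single)
    ultimately have "f = (\<Sum>m\<in>Poly_Mapping.keys f.
        Poly_Mapping.single 0 (Poly_Mapping.lookup f m) * (mono_poly m - mono_poly (N m)))"
      by (simp add: right_diff_distrib sum_subtractf)
    also have "\<dots> \<in> Idl\<^bsub>poly_ring X\<^esub> quadrics"
    proof (rule poly_ideal_sum[OF ideal_Idl_quadrics])
      fix m assume "m \<in> Poly_Mapping.keys f"
      moreover have "Poly_Mapping.single 0 (Poly_Mapping.lookup f m) \<in> carrier (poly_ring X)"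
        by (simp add: monomials_def)
      ultimately show "Poly_Mapping.single 0 (Poly_Mapping.lookup f m) * (mono_poly m - mono_poly (N m))
          \<in> Idl\<^bsub>poly_ring X\<^esub> quadrics"
        by (intro poly_ideal_mult[OF ideal_Idl_quadrics] N(3))
    qed
    finally show "f \<in> Idl\<^bsub>poly_ring X\<^esub> quadrics" .
  qed
qed

text \<open>A kernel element contains a second monomial with the image of its initial one. Were the
  initial one standard, it would be the standard form of the second, hence lighter, against
  maximality.\<close>

lemma initial_mono_not_standard:
  assumes "linear_order_on (monomials X) r"
    and refines: "\<And>m n. m \<in> monomials X \<Longrightarrow> n \<in> monomials X \<Longrightarrow> wt m < wt n \<Longrightarrow> (m, n) \<in> r"
    and f: "f \<in> toric_kernel" "f \<noteq> 0"
  shows "\<not> standard (initial_mono r f)"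
proof
  let ?m = "initial_mono r f"
  assume std: "standard ?m"
  have car: "f \<in> carrier (poly_ring X)" using f by (simp add: toric_kernel_def)
  note init = initial_mono_max[OF assms(1) car f(2)]
  have "\<exists>n\<in>Poly_Mapping.keys f. \<Phi> n = \<Phi> ?m \<and> n \<noteq> ?m"
  proof (rule ccontr)
    assume "\<not> ?thesis"
    then have "{n \<in> Poly_Mapping.keys f. \<Phi> n = \<Phi> ?m} = {?m}" using init(1) by blast
    then have "Poly_Mapping.lookup f ?m = 0"
      using f(1) init(1) by (auto simp: toric_kernel_def toric_ext_eq_0_iff)
    then show False using init(1) by (simp add: in_keys_iff)
  qed
  then obtain n where n: "n \<in> Poly_Mapping.keys f" "\<Phi> n = \<Phi> ?m" "n \<noteq> ?m" by blast
  have nX: "n \<in> monomials X" using n(1) car by auto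
  obtain k where k: "standard k" "\<Phi> k = \<Phi> n" "k \<noteq> n \<longrightarrow> wt k < wt n"
    using standard_form_exists[OF nX] by blast
  have "k = ?m" using standard_unique[OF k(1) std] k(2) n(2) by simp
  then have "(?m, n) \<in> r"
    using k(3) n(3) nX std by (intro refines) (auto simp: standard_def)
  moreover have "antisym r"
    using assms(1) by (simp add: linear_order_on_def partial_order_on_def)
  ultimately show False using init(2)[OF n(1)] n(3) by (auto dest: antisymD)
qed

subsection \<open>The Groebner basis and primality\<close>

lemma quadric_props:
  assumes "linear_order_on (monomials X) r"
    and refines: "\<And>m n. m \<in> monomials X \<Longrightarrow> n \<in> monomials X \<Longrightarrow> wt m < wt n \<Longrightarrow> (m, n) \<in> r"
    and X: "u \<in> monomials X" "v \<in> monomials X" and less: "wt v < wt u"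
  shows quadric_keys: "Poly_Mapping.keys (mono_poly u - mono_poly v) = {u, v}"
    and quadric_initial: "initial_mono r (mono_poly u - mono_poly v) = u"
proof -
  show keys: "Poly_Mapping.keys (mono_poly u - mono_poly v) = {u, v}"
    using less by (intro keys_binomial) auto
  show "initial_mono r (mono_poly u - mono_poly v) = u"
  proof (rule initial_mono_eqI)
    show "antisym r" using assms(1) by (simp add: linear_order_on_def partial_order_on_def)
    show "(n, u) \<in> r" if "n \<in> Poly_Mapping.keys (mono_poly u - mono_poly v)" for n
      using that refines[OF X(2,1) less] X(1) assms(1)
      unfolding keys linear_order_on_def partial_order_on_def preorder_on_def refl_on_def by blast
  qed (simp add: keys)
qed

text \<open>Initial monomials of kernel elements are nonstandard, so each is a multiple of the
  initial monomial of a quadric.\<close>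

lemma initial_ideal_quadrics:
  assumes lin: "linear_order_on (monomials X) r"
    and refines: "\<And>m n. m \<in> monomials X \<Longrightarrow> n \<in> monomials X \<Longrightarrow> wt m < wt n \<Longrightarrow> (m, n) \<in> r"
  shows "initial_ideal X r quadrics = initial_ideal X r toric_kernel"
proof -
  interpret R: cring "poly_ring X" by (rule cring_poly_ring)
  let ?in = "\<lambda>F. {mono_poly (initial_mono r f) | f. f \<in> F \<and> f \<noteq> 0}"
  have car: "?in toric_kernel \<subseteq> carrier (poly_ring X)"
  proof
    fix h assume "h \<in> ?in toric_kernel"
    then obtain f where f: "f \<in> carrier (poly_ring X)" "f \<noteq> 0" "h = mono_poly (initial_mono r f)"
      by (auto simp: toric_kernel_def)
    then have "initial_mono r f \<in> monomials X"
      using initial_mono_max(1)[OF lin f(1,2)] by auto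
    then show "h \<in> carrier (poly_ring X)" using f(3) by simp
  qed
  have sub: "?in quadrics \<subseteq> ?in toric_kernel" using quadrics_subset_kernel by blast
  then have car': "?in quadrics \<subseteq> carrier (poly_ring X)" using car by (rule subset_trans)
  interpret J: ideal "Idl\<^bsub>poly_ring X\<^esub> (?in quadrics)" "poly_ring X"
    by (rule R.genideal_ideal[OF car'])
  have "?in toric_kernel \<subseteq> Idl\<^bsub>poly_ring X\<^esub> (?in quadrics)"
  proof
    fix h assume "h \<in> ?in toric_kernel"
    then obtain f where f: "f \<in> toric_kernel" "f \<noteq> 0" "h = mono_poly (initial_mono r f)" by blast
    have "mono_poly (initial_mono r f) \<in> carrier (poly_ring X)"
      using subsetD[OF car \<open>h \<in> ?in toric_kernel\<close>] unfolding f(3) .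
    then have "initial_mono r f \<in> monomials X" by simp
    then obtain a b a' b' k where red: "a \<in> X" "b \<in> X" "a' \<in> X" "b' \<in> X" "a \<noteq> b" "k \<in> monomials X"
      "initial_mono r f = (unit_mono a + unit_mono b) + k"
      "\<Phi> (unit_mono a' + unit_mono b') = \<Phi> (unit_mono a + unit_mono b)"
      "wt (unit_mono a' + unit_mono b') < wt (unit_mono a + unit_mono b)"
      by (rule nonstandard_reducible[OF _ initial_mono_not_standard[OF lin refines f(1,2)]])
    let ?u = "unit_mono a + unit_mono b" and ?v = "unit_mono a' + unit_mono b'"
    let ?g = "mono_poly ?u - mono_poly ?v"
    have "?g \<in> quadrics" unfolding quadrics_def using red by blast
    have X: "?u \<in> monomials X" "?v \<in> monomials X" by (rule pair_in_monomials, fact, fact)+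
    have "initial_mono r ?g = ?u" by (rule quadric_initial[OF lin refines X red(9)])
    moreover have "?g \<noteq> 0" using quadric_keys[OF lin refines X red(9)] by auto
    ultimately have "mono_poly ?u \<in> ?in quadrics" using \<open>?g \<in> quadrics\<close>
      by (intro CollectI exI[of _ ?g]) simp
    then have "mono_poly ?u \<in> Idl\<^bsub>poly_ring X\<^esub> (?in quadrics)"
      by (rule subsetD[OF R.genideal_self[OF car']])
    moreover have "mono_poly k \<in> carrier (poly_ring X)" using red(6) by simp
    ultimately have "mono_poly ?u * mono_poly k \<in> Idl\<^bsub>poly_ring X\<^esub> (?in quadrics)"
      unfolding mult.commute[of "mono_poly ?u"] by (rule poly_ideal_mult[OF J.is_ideal])
    then show "h \<in> Idl\<^bsub>poly_ring X\<^esub> (?in quadrics)"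
      unfolding f(3) red(7) mono_poly_add[of _ k] .
  qed
  then have "Idl\<^bsub>poly_ring X\<^esub> (?in toric_kernel) \<subseteq> Idl\<^bsub>poly_ring X\<^esub> (?in quadrics)"
    by (rule R.genideal_minimal[OF J.is_ideal])
  moreover have "Idl\<^bsub>poly_ring X\<^esub> (?in quadrics) \<subseteq> Idl\<^bsub>poly_ring X\<^esub> (?in toric_kernel)"
    by (rule R.genideal_minimal[OF R.genideal_ideal[OF car] subset_trans[OF sub R.genideal_self[OF car]]])
  ultimately show ?thesis unfolding initial_ideal_def by (rule equalityI[rotated])
qed

text \<open>Numbering the finitely many features keeps the identifications between monomials, hence
  the kernel, and the target becomes an integral domain.\<close>

lemma primeideal_kernel: "primeideal toric_kernel (poly_ring X)"
proof -
  let ?W = "(\<lambda>(t, a). feat t a) ` ({..p} \<times> X)"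
  have "finite ?W" using finite_X by simp
  then obtain \<mu> :: "'w mono \<Rightarrow> nat mono" where \<mu>: "\<mu> 0 = 0" "\<And>m n. \<mu> (m + n) = \<mu> m + \<mu> n"
    "inj_on \<mu> (monomials ?W)"
    by (rule mono_encoding) blast
  have hom: "alg_hom (Poly_Mapping.single 0) (\<lambda>m. mono_poly (\<mu> (\<Phi> m)))"
    by (rule alg_hom_monomial_map) (simp_all add: \<mu> feature_mono_add)
  have image: "\<Phi> m \<in> monomials ?W" if "m \<in> monomials X" for m
    using that by (force simp: monomials_def in_keys_feature_mono)
  have "toric.ext f = 0 \<longleftrightarrow> alg_hom.ext (Poly_Mapping.single 0) (\<lambda>m. mono_poly (\<mu> (\<Phi> m))) f = 0"
    if "f \<in> carrier (poly_ring X)" for f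
  proof -
    have "\<mu> (\<Phi> n) = \<mu> (\<Phi> m) \<longleftrightarrow> \<Phi> n = \<Phi> m"
      if "n \<in> Poly_Mapping.keys f" "m \<in> Poly_Mapping.keys f" for m n
      using that \<open>f \<in> carrier (poly_ring X)\<close> image by (intro inj_on_eq_iff[OF \<mu>(3)]) auto
    then have "{n \<in> Poly_Mapping.keys f. \<mu> (\<Phi> n) = \<mu> (\<Phi> m)} = {n \<in> Poly_Mapping.keys f. \<Phi> n = \<Phi> m}"
      if "m \<in> Poly_Mapping.keys f" for m
      using that by blast
    then show ?thesis
      unfolding toric_ext_eq_0_iff alg_hom.ext_def[OF hom] monomial_map_kernel by simp
  qed
  then have "toric_kernel = {f \<in> carrier (poly_ring X).
      alg_hom.ext (Poly_Mapping.single 0) (\<lambda>m. mono_poly (\<mu> (\<Phi> m))) f = 0}"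
    unfolding toric_kernel_def by blast
  then show ?thesis using primeideal_ext_kernel[OF hom, of X] by simp
qed

lemma finite_quadrics: "finite quadrics"
proof (rule finite_subset)
  show "quadrics \<subseteq> (\<lambda>(a, b, a', b').
      mono_poly (unit_mono a + unit_mono b) - mono_poly (unit_mono a' + unit_mono b')) ` (X \<times> X \<times> X \<times> X)"
  proof
    fix g assume "g \<in> quadrics"
    then obtain a b a' b' where "a \<in> X" "b \<in> X" "a' \<in> X" "b' \<in> X"
      "g = mono_poly (unit_mono a + unit_mono b) - mono_poly (unit_mono a' + unit_mono b')"
      unfolding quadrics_def by blast
    then show "g \<in> (\<lambda>(a, b, a', b').
        mono_poly (unit_mono a + unit_mono b) - mono_poly (unit_mono a' + unit_mono b')) ` (X \<times> X \<times> X \<times> X)"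
      by (intro image_eqI[of _ _ "(a, b, a', b')"]) simp_all
  qed
qed (simp add: finite_X)

theorem kernel_toric_groebner:
  "toric_ideal X toric_kernel \<and>
    (\<exists>r G. monomial_order X r \<and> groebner_basis X r G toric_kernel \<and> (\<forall>g\<in>G. total_degree g = 2) \<and>
       (\<forall>g\<in>G. squarefree_mono (initial_mono r g)) \<and> toric_kernel = Idl\<^bsub>poly_ring X\<^esub> G)"
proof
  obtain r where r: "monomial_order X r"
    "\<And>m n. m \<in> monomials X \<Longrightarrow> n \<in> monomials X \<Longrightarrow> wt m < wt n \<Longrightarrow> (m, n) \<in> r"
    by (rule monomial_order_refining_weight[OF finite_X, of var_weight]) (use var_weight in blast)+
  have lin: "linear_order_on (monomials X) r"
    using r(1) by (simp add: monomial_order_def well_order_on_def)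
  have binomial: "binomial_poly g" and degree: "total_degree g = 2" and squarefree: "squarefree_mono (initial_mono r g)"
    if quadric: "g \<in> quadrics" for g
  proof -
    obtain a b a' b' where g: "a \<in> X" "b \<in> X" "a' \<in> X" "b' \<in> X" "a \<noteq> b"
      "g = mono_poly (unit_mono a + unit_mono b) - mono_poly (unit_mono a' + unit_mono b')"
      "wt (unit_mono a' + unit_mono b') < wt (unit_mono a + unit_mono b)"
      using quadric unfolding quadrics_def by blast
    note props = quadric_props[OF lin r(2) pair_in_monomials[OF g(1,2)] pair_in_monomials[OF g(3,4)] g(7), folded g(6)]
    show "binomial_poly g" unfolding binomial_poly_def using g(6,7) by (metis less_irrefl)
    have "mono_degree m = weight (\<lambda>_. 1) m" for m :: "'v mono"
      by (simp add: mono_degree_def weight_def)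
    then have "mono_degree (unit_mono u + unit_mono v) = 2" for u v :: 'v
      by (simp add: weight_add weight_single)
    then show "total_degree g = 2" by (simp add: total_degree_def props(1))
    have "squarefree_mono (unit_mono a + unit_mono b)"
      unfolding squarefree_mono_def using g(5) by (auto simp: lookup_add lookup_single when_def)
    then show "squarefree_mono (initial_mono r g)" by (simp only: props(2))
  qed
  show "toric_ideal X toric_kernel"
    unfolding toric_ideal_def
    by (intro conjI exI[of _ quadrics] ballI primeideal_kernel quadrics_subset_carrier binomial
        kernel_eq_Idl_quadrics)
  show "\<exists>r G. monomial_order X r \<and> groebner_basis X r G toric_kernel \<and> (\<forall>g\<in>G. total_degree g = 2) \<and>
      (\<forall>g\<in>G. squarefree_mono (initial_mono r g)) \<and> toric_kernel = Idl\<^bsub>poly_ring X\<^esub> G"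
    unfolding groebner_basis_def
    by (intro exI[of _ r] exI[of _ quadrics] conjI ballI r(1) finite_quadrics quadrics_subset_kernel
        initial_ideal_quadrics[OF lin r(2)] degree squarefree kernel_eq_Idl_quadrics)
qed

end

section \<open>Perfect DAG models with ancestral targets\<close>

section \<open>Perfect interventional DAG models\<close>

text \<open>A sink of the subgraph on \<open>V\<close> receives the last position; the rest is
  enumerated by induction.\<close>

lemma topological_enumeration:
  assumes "finite V" "finite E" "acyclic E"
  shows "\<exists>\<sigma>. bij_betw \<sigma> {1..card V} V \<and>
    (\<forall>s\<in>{1..card V}. \<forall>t\<in>{1..card V}. (\<sigma> s, \<sigma> t) \<in> E \<longrightarrow> s < t)"
  using assms(1)
proof (induction "card V" arbitrary: V)
  case 0
  then show ?case by (auto simp: bij_betw_def)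
next
  case (Suc n)
  have "wf (E\<inverse>)" using assms(2,3) by (rule finite_acyclic_wf_converse)
  moreover obtain v0 where "v0 \<in> V" using Suc(2) by fastforce
  ultimately have "\<exists>v\<in>V. \<forall>w. (w, v) \<in> E\<inverse> \<longrightarrow> w \<notin> V"
    unfolding wf_eq_minimal by blast
  then obtain v where v: "v \<in> V" "\<And>w. (v, w) \<in> E \<Longrightarrow> w \<notin> V"
    by auto
  have n: "n = card (V - {v})" using Suc v(1) by simp
  then obtain \<sigma> where \<sigma>: "bij_betw \<sigma> {1..n} (V - {v})"
    "\<forall>s\<in>{1..n}. \<forall>t\<in>{1..n}. (\<sigma> s, \<sigma> t) \<in> E \<longrightarrow> s < t"
    using Suc(1)[of "V - {v}"] Suc(3) by auto
  let ?\<tau> = "\<sigma>(Suc n := v)"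
  have "bij_betw ?\<tau> {1..n} (V - {v})"
    using \<sigma>(1) by (subst bij_betw_cong[of _ _ \<sigma>]) auto
  moreover have "bij_betw ?\<tau> {Suc n} {v}" by (simp add: bij_betw_def)
  ultimately have "bij_betw ?\<tau> ({1..n} \<union> {Suc n}) ((V - {v}) \<union> {v})"
    by (rule bij_betw_combine) auto
  moreover have "{1..n} \<union> {Suc n} = {1..Suc n}" by auto
  moreover have "(V - {v}) \<union> {v} = V" using v(1) by auto
  ultimately have bij: "bij_betw ?\<tau> {1..Suc n} V" by simp
  have "s < t" if st: "s \<in> {1..Suc n}" "t \<in> {1..Suc n}" "(?\<tau> s, ?\<tau> t) \<in> E" for s t
  proof -
    have "?\<tau> t \<in> V" using bij st(2) by (auto simp: bij_betw_def)
    then have "s \<noteq> Suc n" using v(2) st(3) by auto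
    then show ?thesis using st \<sigma>(2) by (cases "t = Suc n") auto
  qed
  then show ?case using bij unfolding Suc(2)[symmetric] by blast
qed

text \<open>\<open>\<sigma>\<close> lists parents before children and \<open>e\<close> numbers the
  targets, so that the target can act as coordinate 0.\<close>

locale perfect_model =
  fixes p :: nat and d :: "nat \<Rightarrow> nat" and E :: "(nat \<times> nat) set" and \<I> :: "nat set set"
    and \<sigma> :: "nat \<Rightarrow> nat" and e :: "nat set \<Rightarrow> nat"
  assumes d_pos: "k \<in> {1..p} \<Longrightarrow> 1 \<le> d k"
    and targets: "\<I> \<subseteq> Pow {1..p}"
    and edges: "E \<subseteq> {1..p} \<times> {1..p}"
    and perfect: "(i, k) \<in> E \<Longrightarrow> (j, k) \<in> E \<Longrightarrow> i \<noteq> j \<Longrightarrow> (i, j) \<in> E \<or> (j, i) \<in> E"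
    and ancestral: "I \<in> \<I> \<Longrightarrow> j \<in> I \<Longrightarrow> (i, j) \<in> E \<Longrightarrow> i \<in> I"
    and enum: "bij_betw \<sigma> {1..p} {1..p}"
    and enum_edge: "s \<in> {1..p} \<Longrightarrow> t \<in> {1..p} \<Longrightarrow> (\<sigma> s, \<sigma> t) \<in> E \<Longrightarrow> s < t"
    and target_code: "inj_on e \<I>"
begin

abbreviation "pa \<equiv> parents E"

abbreviation "X \<equiv> prob_vars p d \<I>"

text \<open>The target whose conditional distribution of node \<open>j\<close> is used under the target \<open>I\<close>.\<close>

definition stage :: "nat set \<Rightarrow> nat \<Rightarrow> nat set" where
  "stage I j = (if j \<in> I then I else {})"

definition co :: "nat \<Rightarrow> prob_var \<Rightarrow> nat" where
  "co t v = (if t = 0 then e (fst v) else snd v (\<sigma> t))"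

definition cx :: "nat \<Rightarrow> prob_var \<Rightarrow> nat set \<times> (nat \<Rightarrow> nat)" where
  "cx t v = (if t = 0 then ({}, \<lambda>_. 0) else (stage (fst v) (\<sigma> t), restrict (snd v) (pa (\<sigma> t))))"

definition feat :: "nat \<Rightarrow> prob_var \<Rightarrow> param_var" where
  "feat t v = (if t = 0 then A (fst v)
    else Q (stage (fst v) (\<sigma> t)) (\<sigma> t) (snd v (\<sigma> t)) (restrict (snd v) (pa (\<sigma> t))))"

lemma enum_in: "t \<in> {1..p} \<Longrightarrow> \<sigma> t \<in> {1..p}"
  using enum by (auto simp: bij_betw_def)

lemma enum_inj: "s \<in> {1..p} \<Longrightarrow> t \<in> {1..p} \<Longrightarrow> \<sigma> s = \<sigma> t \<longleftrightarrow> s = t"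
  using enum by (auto simp: bij_betw_def inj_on_eq_iff)

lemma enum_surj: "j \<in> {1..p} \<Longrightarrow> \<exists>t\<in>{1..p}. \<sigma> t = j"
  using bij_betw_imp_surj_on[OF enum] by (metis imageE)

lemma parent_index:
  assumes "t \<in> {1..p}" "(i, \<sigma> t) \<in> E"
  obtains s where "s \<in> {1..p}" "s < t" "\<sigma> s = i"
proof -
  have "i \<in> {1..p}" using assms(2) edges by blast
  then obtain s where "s \<in> {1..p}" "\<sigma> s = i" using enum_surj by blast
  then show thesis using enum_edge[of s t] assms that by simp
qed

text \<open>Equal stages at \<open>i\<close> mean \<open>I = J\<close> or \<open>i\<close> outside
  both targets; in the latter case closedness under parents keeps \<open>l\<close> out of both as
  well.\<close>

lemma stage_child:
  assumes "I \<in> \<I>" "J \<in> \<I>" "(i, l) \<in> E" "stage I i = stage J i"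
  shows "stage I l = stage J l"
proof -
  have "l \<in> I \<Longrightarrow> i \<in> I" "l \<in> J \<Longrightarrow> i \<in> J"
    using assms ancestral by blast+
  then show ?thesis using assms(4) by (auto simp: stage_def split: if_splits)
qed

lemma state_in: "(I, x) \<in> X \<longleftrightarrow> I \<in> \<I> \<and> x \<in> states d {1..p}"
  by (simp add: prob_vars_def)

subsection \<open>Swapping the descendants that see a difference\<close>

text \<open>Exchanging a node alters the parent state of its children only if the two states differ
  there, so membership propagates through such nodes alone.\<close>

inductive_set affected :: "(nat \<Rightarrow> nat) \<Rightarrow> (nat \<Rightarrow> nat) \<Rightarrow> nat \<Rightarrow> nat set"
  for x y :: "nat \<Rightarrow> nat" and j :: nat where
  start: "j \<in> affected x y j"
| step: "i \<in> affected x y j \<Longrightarrow> x i \<noteq> y i \<Longrightarrow> (i, l) \<in> E \<Longrightarrow> l \<in> affected x y j"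

lemma affected_commute: "affected x y j = affected y x j"
proof -
  have "affected x y j \<subseteq> affected y x j" for x y
  proof
    fix l assume "l \<in> affected x y j"
    then show "l \<in> affected y x j"
    proof induction
      case (step i l)
      then show ?case by (intro affected.step[of i y x j l]) auto
    qed (rule affected.start)
  qed
  then show ?thesis by blast
qed

lemma affected_index:
  assumes "l \<in> affected x y (\<sigma> t)" "t \<in> {1..p}"
  shows "\<exists>s\<in>{t..p}. \<sigma> s = l"
  using assms(1)
proof induction
  case start
  then show ?case using assms(2) by (intro bexI[of _ t]) auto
next
  case (step i l)
  then obtain s where s: "s \<in> {t..p}" "\<sigma> s = i" by blast
  have "l \<in> {1..p}" using edges step(3) by blast
  then obtain s' where s': "s' \<in> {1..p}" "\<sigma> s' = l" using enum_surj by blast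
  have "s < s'" using s s' step(3) assms(2) by (intro enum_edge) auto
  then show ?case using s s' by (intro bexI[of _ s']) auto
qed

lemma affected_stage:
  assumes "I \<in> \<I>" "J \<in> \<I>" "stage I j = stage J j" "l \<in> affected x y j"
  shows "stage I l = stage J l"
  using assms(4)
proof induction
  case (step i l)
  show ?case by (rule stage_child[OF assms(1,2) step.hyps(3) step.IH])
qed (rule assms(3))

text \<open>Perfectness at work: \<open>l\<close> was reached through some parent \<open>k\<close>,
  and another parent \<open>i\<close> is adjacent to \<open>k\<close>. As a child of
  \<open>k\<close> it is affected too; as a parent of \<open>k\<close> it is covered by
  induction.\<close>

lemma affected_parent:
  assumes "l \<in> affected x y j" "(i, l) \<in> E" "\<And>i. (i, j) \<in> E \<Longrightarrow> x i = y i"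
  shows "i \<in> affected x y j \<or> x i = y i"
  using assms(1,2)
proof (induction arbitrary: i)
  case start
  then show ?case using assms(3) by blast
next
  case (step k l)
  consider "i = k" | "(k, i) \<in> E" | "(i, k) \<in> E"
    using perfect[OF step.hyps(3) step.prems] by blast
  then show ?case
  proof cases
    case 1
    then show ?thesis using step.hyps(1) by simp
  next
    case 2
    then show ?thesis using affected.step[OF step.hyps(1,2)] by simp
  next
    case 3
    then show ?thesis by (rule step.IH)
  qed
qed

definition exchange :: "(nat \<Rightarrow> nat) \<Rightarrow> (nat \<Rightarrow> nat) \<Rightarrow> nat \<Rightarrow> nat \<Rightarrow> nat" where
  "exchange x y j = (\<lambda>i. if i \<in> affected x y j then y i else x i)"

lemma exchange_in_states:
  "x \<in> states d {1..p} \<Longrightarrow> y \<in> states d {1..p} \<Longrightarrow> exchange x y j \<in> states d {1..p}"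
  by (auto simp: states_def exchange_def PiE_iff extensional_def)

text \<open>An affected node sees the parent state of \<open>y\<close>, since its parents are
  exchanged or agree; an unaffected one keeps that of \<open>x\<close>, since \<open>x\<close> and
  \<open>y\<close> agree at its affected parents.\<close>

lemma feat_exchange:
  assumes "I \<in> \<I>" "J \<in> \<I>" "t \<in> {1..p}" "stage I (\<sigma> t) = stage J (\<sigma> t)"
    "restrict x (pa (\<sigma> t)) = restrict y (pa (\<sigma> t))"
  shows "feat s (I, exchange x y (\<sigma> t)) =
    (if s \<noteq> 0 \<and> \<sigma> s \<in> affected x y (\<sigma> t) then feat s (J, y) else feat s (I, x))"
proof -
  let ?D = "affected x y (\<sigma> t)"
  have eq: "x i = y i" if "(i, \<sigma> t) \<in> E" for i
    using fun_cong[OF assms(5), of i] that by (simp add: parents_def)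
  have "restrict (exchange x y (\<sigma> t)) (pa l) = restrict y (pa l)" if "l \<in> ?D" for l
    using affected_parent[OF that _ eq] by (auto simp: restrict_def exchange_def parents_def fun_eq_iff)
  moreover have "restrict (exchange x y (\<sigma> t)) (pa l) = restrict x (pa l)" if "l \<notin> ?D" for l
  proof -
    have "x i = y i" if "i \<in> ?D" "(i, l) \<in> E" for i
      using affected.step[OF that(1) _ that(2)] \<open>l \<notin> ?D\<close> by blast
    then show ?thesis by (auto simp: restrict_def exchange_def parents_def fun_eq_iff)
  qed
  ultimately show ?thesis
    using affected_stage[OF assms(1,2,4)] by (auto simp: feat_def exchange_def)
qed

text \<open>Both variables keep their targets and exchange the states on the affected set, so they
  trade the features there and the product of all features is unchanged.\<close>

lemma swap_exists:
  assumes "a \<in> X" "b \<in> X" "0 < t" "t \<le> p" "cx t a = cx t b"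
  shows "\<exists>a'\<in>X. \<exists>b'\<in>X.
    feature_mono feat p (unit_mono a' + unit_mono b') = feature_mono feat p (unit_mono a + unit_mono b) \<and>
    (\<forall>s<t. co s a' = co s a \<and> co s b' = co s b) \<and> co t a' = co t b \<and> co t b' = co t a \<and>
    (\<forall>s\<le>p. co s a' + co s b' = co s a + co s b)"
proof -
  obtain I x J y where ab: "a = (I, x)" "b = (J, y)" by (metis surj_pair)
  have X: "I \<in> \<I>" "J \<in> \<I>" "x \<in> states d {1..p}" "y \<in> states d {1..p}"
    using assms(1,2) by (simp_all add: ab state_in)
  have t: "t \<in> {1..p}" using assms(3,4) by simp
  have same: "stage I (\<sigma> t) = stage J (\<sigma> t)" "restrict x (pa (\<sigma> t)) = restrict y (pa (\<sigma> t))"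
    using assms(3,5) by (simp_all add: cx_def ab)
  let ?D = "affected x y (\<sigma> t)"
  let ?a = "(I, exchange x y (\<sigma> t))" and ?b = "(J, exchange y x (\<sigma> t))"
  have D: "affected y x (\<sigma> t) = ?D" by (rule affected_commute)
  have "Poly_Mapping.single (feat s ?a) 1 + Poly_Mapping.single (feat s ?b) 1 =
      Poly_Mapping.single (feat s a) 1 + (Poly_Mapping.single (feat s b) 1 :: param_var mono)" for s
    unfolding feat_exchange[OF X(1,2) t same] feat_exchange[OF X(2,1) t same[symmetric]] D ab
    by (simp add: add.commute)
  then have "feature_mono feat p (unit_mono ?a + unit_mono ?b) = feature_mono feat p (unit_mono a + unit_mono b)"
    by (simp only: feature_mono_add feature_mono_single sum.distrib[symmetric])
  moreover have "?a \<in> X" "?b \<in> X"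
    unfolding state_in by (intro conjI exchange_in_states X)+
  moreover have "co s ?a = co s a \<and> co s ?b = co s b" if "s < t" for s
  proof -
    have "\<sigma> s \<notin> ?D" if "s \<noteq> 0"
    proof
      assume "\<sigma> s \<in> ?D"
      then obtain s' where "s' \<in> {t..p}" "\<sigma> s' = \<sigma> s" using affected_index t by blast
      then show False using enum_inj[of s' s] \<open>s < t\<close> that t by auto
    qed
    then show ?thesis by (simp add: co_def ab exchange_def D)
  qed
  moreover have "co t ?a = co t b" "co t ?b = co t a"
    using assms(3) affected.start[of "\<sigma> t"] by (simp_all add: co_def ab exchange_def)
  moreover have "co s ?a + co s ?b = co s a + co s b" for s
    by (simp add: co_def ab exchange_def D)
  ultimately show ?thesis by blast
qed

sublocale feature_system X p co cx feat
proof
  show "finite X"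
    using targets finite_subset[of \<I> "Pow {1..p}"] by (auto simp: prob_vars_def states_def intro!: finite_PiE)
next
  fix a b s t assume "a \<in> X" "b \<in> X" "s \<le> p" "t \<le> p"
  then show "feat s a = feat t b \<longleftrightarrow> s = t \<and> cx s a = cx t b \<and> co s a = co t b"
    using enum_inj[of s t] target_code
    by (cases a; cases b) (auto simp: feat_def cx_def co_def state_in inj_on_eq_iff)
next
  fix a b assume X: "a \<in> X" "b \<in> X" and co: "\<And>t. t \<le> p \<Longrightarrow> co t a = co t b"
  have "fst a = fst b"
    using co[of 0] target_code X by (cases a; cases b) (auto simp: co_def state_in inj_on_eq_iff)
  moreover have "snd a = snd b"
  proof (rule PiE_ext[of _ "{1..p}"])
    fix i assume "i \<in> {1..p}"
    then obtain t where "t \<in> {1..p}" "\<sigma> t = i" using enum_surj by blast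
    then show "snd a i = snd b i" using co[of t] by (auto simp: co_def)
  qed (use X in \<open>auto simp: prob_vars_def states_def\<close>)
  ultimately show "a = b" by (rule prod_eqI)
next
  fix a b t assume X: "a \<in> X" "b \<in> X" and t: "t \<le> p" and co: "\<And>s. s < t \<Longrightarrow> co s a = co s b"
  show "cx t a = cx t b"
  proof (cases "t = 0")
    case False
    then have "fst a = fst b"
      using co[of 0] target_code X by (cases a; cases b) (auto simp: co_def state_in inj_on_eq_iff)
    moreover have "snd a i = snd b i" if "i \<in> pa (\<sigma> t)" for i
    proof -
      have "t \<in> {1..p}" "(i, \<sigma> t) \<in> E" using that t False by (auto simp: parents_def)
      then obtain s where "s \<in> {1..p}" "s < t" "\<sigma> s = i" by (rule parent_index)
      then show ?thesis using co[of s] by (auto simp: co_def)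
    qed
    ultimately show ?thesis using False by (simp add: cx_def restrict_def fun_eq_iff)
  qed (simp add: cx_def)
qed (rule swap_exists)

subsection \<open>Renormalising positive parameters\<close>

definition prob :: "(param_var \<Rightarrow> real) \<Rightarrow> prob_var \<Rightarrow> real" where
  "prob \<theta> v = (\<Prod>t\<le>p. \<theta> (feat t v))"

definition total :: "(param_var \<Rightarrow> real) \<Rightarrow> nat \<Rightarrow> nat set \<Rightarrow> (nat \<Rightarrow> nat) \<Rightarrow> real" where
  "total \<theta> j I y = (\<Sum>x\<in>{1..d j}. \<theta> (Q I j x y))"

text \<open>If \<open>j\<close> is in \<open>I\<close>, so is its parent \<open>k\<close>; otherwise
  both sides are empty. Thus the stage at a parent determines that of the child.\<close>

lemma stage_stage:
  "I \<in> \<I> \<Longrightarrow> (k, j) \<in> E \<Longrightarrow> stage (stage I k) j = stage I j"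
  using ancestral[of I j k] by (auto simp: stage_def)

text \<open>The total of node \<open>\<sigma> t\<close> is a function of the feature of its last parent, because that
  parent together with its own parents contains all parents of \<open>\<sigma> t\<close>; a node without parents has
  its total absorbed by the homogenizing variable.\<close>

lemma absorbing_feature:
  assumes "t \<in> {1..p}"
  obtains u c where "u < t" "\<And>v. v \<in> X \<Longrightarrow> c (feat u v) = cx t v"
proof (cases "pa (\<sigma> t) = {}")
  case True
  \<comment> \<open>Without parents, the parent state is the everywhere undefined function and the
    context depends on the target only.\<close>
  show thesis
  proof (rule that[of 0 "\<lambda>w. case w of A I \<Rightarrow> (stage I (\<sigma> t), \<lambda>_. undefined) | _ \<Rightarrow> undefined"])
    show "(case feat 0 v of A I \<Rightarrow> (stage I (\<sigma> t), \<lambda>_. undefined) | _ \<Rightarrow> undefined) = cx t v" for v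
      using assms True by (auto simp: feat_def cx_def restrict_def)
  qed (use assms in auto)
next
  case False
  let ?S = "{s \<in> {1..p}. (\<sigma> s, \<sigma> t) \<in> E}"
  obtain i where i: "(i, \<sigma> t) \<in> E" using False by (auto simp: parents_def)
  have "?S \<noteq> {}"
    by (rule parent_index[OF assms i]) (use i in auto)
  then have "Max ?S \<in> ?S" by (intro Max_in) auto
  then obtain u where u: "u = Max ?S" "u \<in> {1..p}" "(\<sigma> u, \<sigma> t) \<in> E" by blast
  have cover: "i = \<sigma> u \<or> (i, \<sigma> u) \<in> E" if i: "(i, \<sigma> t) \<in> E" for i
  proof (rule ccontr)
    assume "\<not> ?thesis"
    then have "(\<sigma> u, i) \<in> E" using perfect[OF i u(3)] by blast
    moreover obtain s where s: "s \<in> {1..p}" "\<sigma> s = i" by (rule parent_index[OF assms i])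
    ultimately have "u < s" using enum_edge[of u s] u(2) by simp
    moreover have "s \<le> u" unfolding u(1) using s i by (intro Max_ge) auto
    ultimately show False by simp
  qed
  \<comment> \<open>The parent state of \<open>\<sigma> t\<close> is read off from \<open>y\<close>,
    extended by the value \<open>x\<close> of the node \<open>k = \<sigma> u\<close> itself.\<close>
  show thesis
  proof (rule that[of u "\<lambda>w. case w of
      Q I k x y \<Rightarrow> (stage I (\<sigma> t), restrict (y(k := x)) (pa (\<sigma> t))) | _ \<Rightarrow> undefined"])
    show "u < t" using enum_edge[OF u(2) assms u(3)] .
    fix v assume "v \<in> X"
    then have "stage (stage (fst v) (\<sigma> u)) (\<sigma> t) = stage (fst v) (\<sigma> t)"
      using stage_stage[OF _ u(3)] by (cases v) (simp add: state_in)
    then show "(case feat u v of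
        Q I k x y \<Rightarrow> (stage I (\<sigma> t), restrict (y(k := x)) (pa (\<sigma> t))) | _ \<Rightarrow> undefined) = cx t v"
      using u(2) assms cover by (auto simp: feat_def cx_def restrict_def parents_def fun_eq_iff)
  qed
qed

text \<open>The parameters of \<open>\<sigma> t\<close> are divided by their totals, and the feature
  at \<open>u\<close> absorbs the same totals, recovered through \<open>c\<close>; in
  \<open>prob\<close> the factors cancel. As \<open>u < t\<close>, later nodes keep their
  totals.\<close>

lemma renormalise_node:
  assumes "t \<in> {1..p}" and pos: "\<forall>w. 0 < \<theta> w"
  obtains \<theta>' where "\<forall>w. 0 < \<theta>' w" "\<And>v. v \<in> X \<Longrightarrow> prob \<theta>' v = prob \<theta> v"
    "\<And>I y. total \<theta>' (\<sigma> t) I y = 1"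
    "\<And>s I y. s \<in> {1..p} \<Longrightarrow> t < s \<Longrightarrow> total \<theta>' (\<sigma> s) I y = total \<theta> (\<sigma> s) I y"
proof -
  obtain u c where u: "u < t" and c: "\<And>v. v \<in> X \<Longrightarrow> c (feat u v) = cx t v"
    by (rule absorbing_feature[OF assms(1)]) blast
  let ?j = "\<sigma> t"
  have total_pos: "0 < total \<theta> ?j I y" for I y
    unfolding total_def using pos d_pos[OF enum_in[OF assms(1)]] by (intro sum_pos) auto
  define h where "h w = (case w of A _ \<Rightarrow> if u = 0 then case_prod (total \<theta> ?j) (c w) else 1
    | Q I l x y \<Rightarrow> if l = ?j then inverse (total \<theta> ?j I y)
        else if u \<noteq> 0 \<and> l = \<sigma> u then case_prod (total \<theta> ?j) (c w) else 1)" for w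
  define \<theta>' where "\<theta>' w = \<theta> w * h w" for w
  have "0 < h w" for w
    by (cases w) (auto simp: h_def total_pos split: prod.split)
  then have "\<forall>w. 0 < \<theta>' w" using pos by (simp add: \<theta>'_def)
  moreover have "prob \<theta>' v = prob \<theta> v" if v: "v \<in> X" for v
  proof -
    define z where "z = case_prod (total \<theta> ?j) (cx t v)"
    have "z \<noteq> 0" using total_pos by (auto simp: z_def split: prod.split) (metis less_irrefl)
    have "h (feat s v) = (if s = t then inverse z else 1) * (if s = u then z else 1)" if s: "s \<le> p" for s
    proof (cases "s = 0")
      case True
      then show ?thesis using c[OF v] assms(1) by (auto simp: h_def feat_def z_def)
    next
      case False
      then have "\<sigma> s = ?j \<longleftrightarrow> s = t" "u \<noteq> 0 \<Longrightarrow> \<sigma> s = \<sigma> u \<longleftrightarrow> s = u"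
        using s u assms(1) by (auto intro!: enum_inj)
      then show ?thesis using False c[OF v] u assms(1)
        by (cases "s = t"; cases "s = u") (auto simp: h_def feat_def z_def cx_def)
    qed
    then have "(\<Prod>s\<le>p. h (feat s v)) =
        (\<Prod>s\<le>p. (if s = t then inverse z else 1) * (if s = u then z else 1))"
      by (intro prod.cong) auto
    also have "\<dots> = 1"
      using u assms(1) \<open>z \<noteq> 0\<close> by (simp add: prod.distrib)
    finally show ?thesis by (simp add: prob_def \<theta>'_def prod.distrib)
  qed
  moreover have "total \<theta>' ?j I y = 1" for I y
    using total_pos[of I y] unfolding total_def \<theta>'_def
    by (simp add: h_def sum_distrib_right[symmetric] total_def)
  moreover have "total \<theta>' (\<sigma> s) I y = total \<theta> (\<sigma> s) I y" if "s \<in> {1..p}" "t < s" for s I y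
  proof -
    have "\<sigma> s \<noteq> ?j" "\<not> (u \<noteq> 0 \<and> \<sigma> s = \<sigma> u)"
      using that u enum_inj[of s t] enum_inj[of s u] assms(1) by auto
    then show ?thesis by (simp only: total_def \<theta>'_def h_def param_var.case if_False mult_1_right)
  qed
  ultimately show thesis by (rule that)
qed

lemma renormalise:
  assumes "\<forall>w. 0 < \<theta> w"
  obtains \<theta>' where "\<And>v. v \<in> X \<Longrightarrow> prob \<theta>' v = prob \<theta> v"
    "\<And>I j y. j \<in> {1..p} \<Longrightarrow> total \<theta>' j I y = 1"
    "\<And>I J j x y. j \<notin> I \<union> J \<Longrightarrow> \<theta>' (Q I j x y) = \<theta>' (Q J j x y)"
proof -
  \<comment> \<open>After \<open>n\<close> rounds the last \<open>n\<close> positions are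
    normalised; the next round treats position \<open>p - n\<close> and otherwise disturbs only
    earlier ones.\<close>
  have "\<exists>\<theta>'. (\<forall>w. 0 < \<theta>' w) \<and> (\<forall>v\<in>X. prob \<theta>' v = prob \<theta> v) \<and>
    (\<forall>s\<in>{1..p}. p - n < s \<longrightarrow> (\<forall>I y. total \<theta>' (\<sigma> s) I y = 1))" if "n \<le> p" for n
    using that
  proof (induction n)
    case 0
    then show ?case using assms by auto
  next
    case (Suc n)
    then obtain \<eta> where \<eta>: "\<forall>w. 0 < \<eta> w" "\<forall>v\<in>X. prob \<eta> v = prob \<theta> v"
      "\<forall>s\<in>{1..p}. p - n < s \<longrightarrow> (\<forall>I y. total \<eta> (\<sigma> s) I y = 1)" by auto
    have "p - n \<in> {1..p}" using Suc.prems by auto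
    then obtain \<theta>' where \<theta>': "\<forall>w. 0 < \<theta>' w" "\<And>v. v \<in> X \<Longrightarrow> prob \<theta>' v = prob \<eta> v"
      "\<And>I y. total \<theta>' (\<sigma> (p - n)) I y = 1"
      "\<And>s I y. s \<in> {1..p} \<Longrightarrow> p - n < s \<Longrightarrow> total \<theta>' (\<sigma> s) I y = total \<eta> (\<sigma> s) I y"
      by (rule renormalise_node[OF _ \<eta>(1)]) blast
    have "total \<theta>' (\<sigma> s) I y = 1" if "s \<in> {1..p}" "p - Suc n < s" for s I y
    proof (cases "s = p - n")
      case False
      then have "p - n < s" using that by simp
      then show ?thesis using \<theta>'(4) \<eta>(3) that(1) by simp
    qed (simp add: \<theta>'(3))
    then show ?case using \<theta>'(1,2) \<eta>(2) by (intro exI[of _ \<theta>']) simp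
  qed
  from this[of p] obtain \<eta> where \<eta>: "\<forall>v\<in>X. prob \<eta> v = prob \<theta> v"
    "\<forall>s\<in>{1..p}. \<forall>I y. total \<eta> (\<sigma> s) I y = 1" by auto
  \<comment> \<open>Features carry stages as targets, so reading each parameter at its stage changes
    no probability and makes the parameters of targets avoiding \<open>j\<close> coincide.\<close>
  define \<theta>' where "\<theta>' w = (case w of A I \<Rightarrow> \<eta> (A I) | Q I j x y \<Rightarrow> \<eta> (Q (stage I j) j x y))" for w
  have "\<theta>' (feat t v) = \<eta> (feat t v)" for t v
    by (simp add: \<theta>'_def feat_def stage_def)
  then have "prob \<theta>' v = prob \<eta> v" for v by (simp add: prob_def)
  moreover have "total \<theta>' j I y = 1" if "j \<in> {1..p}" for I j y
  proof -
    have "total \<theta>' j I y = total \<eta> j (stage I j) y" by (simp add: total_def \<theta>'_def)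
    then show ?thesis using enum_surj[OF that] \<eta>(2) by auto
  qed
  ultimately show thesis
    using \<eta>(1) by (intro that[of \<theta>']) (auto simp: \<theta>'_def stage_def)
qed

section \<open>Comparison of the factorization ideal with the toric kernel\<close>

lemma param_image_eq:
  assumes "v \<in> X"
  shows "param_image p E v = mono_poly (\<Sum>t\<le>p. Poly_Mapping.single (feat t v) 1)"
proof -
  obtain I x where v: "v = (I, x)" by (cases v)
  have I: "I \<subseteq> {1..p}" "finite I" using assms targets finite_subset[of I "{1..p}"] by (auto simp: v state_in)
  let ?q = "\<lambda>j. Q (stage I j) j (x j) (restrict x (pa j))"
  have "{..p} = insert 0 {1..p}" by auto
  then have "(\<Prod>t\<le>p. var (feat t v)) = var (feat 0 v) * (\<Prod>t\<in>{1..p}. var (feat t v))"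
    by simp
  also have "(\<Prod>t\<in>{1..p}. var (feat t v)) = (\<Prod>t\<in>{1..p}. var (?q (\<sigma> t)))"
    by (intro prod.cong) (auto simp: feat_def v)
  also have "\<dots> = (\<Prod>j\<in>{1..p}. var (?q j))"
    by (rule prod.reindex_bij_betw[OF enum])
  also have "\<dots> = (\<Prod>j\<in>I. var (?q j)) * (\<Prod>j\<in>{1..p} - I. var (?q j))"
    using I by (subst prod.subset_diff[of I]) (simp_all add: mult.commute)
  finally have split: "(\<Prod>t\<le>p. var (feat t v)) =
    var (feat 0 v) * ((\<Prod>j\<in>I. var (?q j)) * (\<Prod>j\<in>{1..p} - I. var (?q j)))" .
  have "(\<Prod>j\<in>I. var (?q j)) = (\<Prod>j\<in>I. var (Q I j (x j) (restrict x (pa j))))"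
    by (intro prod.cong) (auto simp: stage_def)
  moreover have "(\<Prod>j\<in>{1..p} - I. var (?q j)) = (\<Prod>j\<in>{1..p} - I. var (Q {} j (x j) (restrict x (pa j))))"
    by (intro prod.cong) (auto simp: stage_def)
  moreover have "feat 0 v = A I" by (simp add: feat_def v)
  ultimately have "(\<Prod>t\<le>p. var (feat t v)) = param_image p E v"
    unfolding split by (simp only: param_image_def v prod.case mult.assoc)
  then show ?thesis by (simp add: mono_poly_sum var_def)
qed

lemma poly_subst_eq: "f \<in> carrier (poly_ring X) \<Longrightarrow> poly_subst (param_image p E) f = toric.ext f"
  unfolding toric.ext_def by (rule poly_subst_monomial_map[OF param_image_eq])

text \<open>The value of an image polynomial at \<open>\<theta>\<close> depends on
  \<open>\<theta>\<close> only through \<open>prob\<close>, which renormalisation preserves.\<close>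

lemma eval_toric:
  "alg_hom.ext id (mono_eval \<theta>) (toric.ext f) =
    (\<Sum>m\<in>Poly_Mapping.keys f. Poly_Mapping.lookup f m *
      (\<Prod>v\<in>Poly_Mapping.keys m. prob \<theta> v ^ Poly_Mapping.lookup m v))"
proof -
  interpret ev: alg_hom id "mono_eval \<theta>" by (rule alg_hom_mono_eval)
  show ?thesis
    by (simp add: toric.ext_def ev.ext_sum ev.ext_mult ev.ext_single mono_eval_feature_mono prob_def)
qed

lemma param_var_closed:
  assumes "I \<in> \<I>" "j \<in> {1..p}" "x \<in> {1..d j}" "y \<in> states d (pa j)"
  shows "var (Q I j x y) \<in> carrier (poly_ring (param_vars p d E \<I>))"
proof -
  have "Q I j x y \<in> param_vars p d E \<I>" using assms by (simp add: param_vars_def)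
  then show ?thesis
    unfolding var_def poly_ring_simps mono_poly_in_carrier by (rule unit_mono_in_monomials)
qed

abbreviation "param_generators \<equiv>
  {(\<Sum>x\<in>{1..d j}. var (Q I j x y)) - 1 | I j y. I \<in> \<I> \<and> j \<in> {1..p} \<and> y \<in> states d (pa j)} \<union>
  {var (Q I j x y) - var (Q J j x y) | I J j x y.
    I \<in> \<I> \<and> J \<in> \<I> \<and> j \<in> {1..p} - (I \<union> J) \<and> x \<in> {1..d j} \<and> y \<in> states d (pa j)}"

lemma param_generators_closed: "param_generators \<subseteq> carrier (poly_ring (param_vars p d E \<I>))"
proof (intro Un_least subsetI)
  let ?R = "poly_ring (param_vars p d E \<I>)"
  interpret R: cring ?R by (rule cring_poly_ring)
  fix g assume "g \<in> {(\<Sum>x\<in>{1..d j}. var (Q I j x y)) - 1 | I j y.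
    I \<in> \<I> \<and> j \<in> {1..p} \<and> y \<in> states d (pa j)}"
  then obtain I j y where g: "g = (\<Sum>x\<in>{1..d j}. var (Q I j x y)) - 1" "I \<in> \<I>" "j \<in> {1..p}"
    "y \<in> states d (pa j)" by blast
  have "(\<Sum>x\<in>{1..d j}. var (Q I j x y)) \<in> carrier ?R"
    by (rule poly_ideal_sum[OF R.oneideal]) (rule param_var_closed[OF g(2,3) _ g(4)])
  moreover have "1 \<in> carrier ?R" by (simp add: monomials_def)
  ultimately show "g \<in> carrier ?R" unfolding g(1) by (rule poly_ring_diff_closed)
next
  fix g assume "g \<in> {var (Q I j x y) - var (Q J j x y) | I J j x y.
    I \<in> \<I> \<and> J \<in> \<I> \<and> j \<in> {1..p} - (I \<union> J) \<and> x \<in> {1..d j} \<and> y \<in> states d (pa j)}"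
  then obtain I J j x y where g: "g = var (Q I j x y) - var (Q J j x y)" "I \<in> \<I>" "J \<in> \<I>"
    "j \<in> {1..p}" "x \<in> {1..d j}" "y \<in> states d (pa j)" by blast
  show "g \<in> carrier (poly_ring (param_vars p d E \<I>))"
    unfolding g(1) by (intro poly_ring_diff_closed param_var_closed g)
qed

lemma param_ideal_subset_kernel:
  assumes total: "\<And>I j y. j \<in> {1..p} \<Longrightarrow> total \<theta> j I y = 1"
    and same: "\<And>I J j x y. j \<notin> I \<union> J \<Longrightarrow> \<theta> (Q I j x y) = \<theta> (Q J j x y)"
  shows "param_ideal p d E \<I> \<subseteq>
    {g \<in> carrier (poly_ring (param_vars p d E \<I>)). alg_hom.ext id (mono_eval \<theta>) g = 0}"
proof -
  interpret ev: alg_hom id "mono_eval \<theta>" by (rule alg_hom_mono_eval)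
  let ?R = "poly_ring (param_vars p d E \<I>)"
  have eval_var: "ev.ext (var w) = \<theta> w" for w
    by (simp add: var_def mono_eval_single)
  have "ev.ext g = 0" if "g \<in> param_generators" for g
    using that
  proof
    assume "g \<in> {(\<Sum>x\<in>{1..d j}. var (Q I j x y)) - 1 | I j y.
      I \<in> \<I> \<and> j \<in> {1..p} \<and> y \<in> states d (pa j)}"
    then obtain I j y where g: "g = (\<Sum>x\<in>{1..d j}. var (Q I j x y)) - 1" "j \<in> {1..p}" by blast
    show ?thesis
      using total[OF g(2), of I y] by (simp add: g(1) ev.ext_diff ev.ext_sum eval_var total_def)
  next
    assume "g \<in> {var (Q I j x y) - var (Q J j x y) | I J j x y.
      I \<in> \<I> \<and> J \<in> \<I> \<and> j \<in> {1..p} - (I \<union> J) \<and> x \<in> {1..d j} \<and> y \<in> states d (pa j)}"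
    then obtain I J j x y where g: "g = var (Q I j x y) - var (Q J j x y)" "j \<notin> I \<union> J" by blast
    show ?thesis
      using same[OF g(2)] by (simp add: g(1) ev.ext_diff eval_var)
  qed
  then have "param_generators \<subseteq> {g \<in> carrier ?R. ev.ext g = 0}"
    using param_generators_closed by blast
  then show ?thesis
    unfolding param_ideal_def
    by (rule ring.genideal_minimal[OF cring.axioms(1)[OF cring_poly_ring] ev.ideal_ext_kernel])
qed

text \<open>At a positive \<open>\<theta>\<close> the image has the same value as at the
  renormalised parameters, where the whole ideal vanishes. Vanishing at all positive points, it has
  only zero coefficients.\<close>

lemma toric_ext_eq_0_if_in_param_ideal:
  assumes f: "f \<in> carrier (poly_ring X)" and mem: "toric.ext f \<in> param_ideal p d E \<I>"
  shows "toric.ext f = 0"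
proof -
  let ?g = "toric.ext f"
  have "(\<Sum>m\<in>Poly_Mapping.keys ?g. Poly_Mapping.lookup ?g m * mono_eval \<theta> m) = 0"
    if pos: "\<And>w. 0 < \<theta> w" for \<theta>
  proof -
    obtain \<theta>' where \<theta>': "\<And>v. v \<in> X \<Longrightarrow> prob \<theta>' v = prob \<theta> v"
      "\<And>I j y. j \<in> {1..p} \<Longrightarrow> total \<theta>' j I y = 1"
      "\<And>I J j x y. j \<notin> I \<union> J \<Longrightarrow> \<theta>' (Q I j x y) = \<theta>' (Q J j x y)"
      by (rule renormalise[of \<theta>]) (use pos in auto)
    have vars: "v \<in> X" if "m \<in> Poly_Mapping.keys f" "v \<in> Poly_Mapping.keys m" for m v
      using f that by (auto simp: monomials_def)
    have "alg_hom.ext id (mono_eval \<theta>) ?g = alg_hom.ext id (mono_eval \<theta>') ?g"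
      unfolding eval_toric using \<theta>'(1) vars by (intro sum.cong prod.cong arg_cong2[of _ _ _ _ "(*)"] refl) simp
    also have "\<dots> = 0"
      using param_ideal_subset_kernel[of \<theta>', OF \<theta>'(2,3)] mem by blast
    finally show ?thesis by (simp add: alg_hom.ext_def[OF alg_hom_mono_eval])
  qed
  then have "Poly_Mapping.lookup ?g m = 0" if "m \<in> Poly_Mapping.keys ?g" for m
    using that by (intro mono_eval_independent[OF finite_keys, where c = "Poly_Mapping.lookup ?g"]) auto
  then show ?thesis by (intro poly_mapping_eqI) (metis in_keys_iff lookup_zero)
qed

text \<open>A trivial coset forces the image into \<open>param_ideal\<close>, where only the zero
  image occurs.\<close>

lemma factorization_ideal_eq_kernel: "factorization_ideal p d E \<I> = toric_kernel"
proof -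
  let ?R = "poly_ring (param_vars p d E \<I>)" and ?J = "param_ideal p d E \<I>"
  have zero: "0 \<in> ?J"
  proof (rule poly_ideal_zero)
    interpret R: cring ?R by (rule cring_poly_ring)
    show "ideal ?J ?R"
      unfolding param_ideal_def by (rule R.genideal_ideal[OF param_generators_closed])
  qed
  have "factorization_map p d E \<I> f = ?J \<longleftrightarrow> toric.ext f = 0" if f: "f \<in> carrier (poly_ring X)" for f
  proof -
    have coset: "factorization_map p d E \<I> f = (\<lambda>h. h + toric.ext f) ` ?J"
      by (auto simp: factorization_map_def a_r_coset_def' poly_subst_eq[OF f])
    show ?thesis
    proof
      assume "factorization_map p d E \<I> f = ?J"
      then have "0 + toric.ext f \<in> ?J" using zero unfolding coset by blast
      then show "toric.ext f = 0" using toric_ext_eq_0_if_in_param_ideal[OF f] by simp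
    qed (simp add: coset)
  qed
  then show ?thesis
    unfolding factorization_ideal_def a_kernel_def' toric_kernel_def by (auto simp: FactRing_def)
qed

end

theorem corollary3p3:
  fixes p :: nat and d :: "nat \<Rightarrow> nat" and E :: "(nat \<times> nat) set" and \<I> :: "nat set set"
  assumes "\<forall>k\<in>{1..p}. d k \<ge> 1"
    and "\<I> \<subseteq> Pow {1..p}"
    and "{} \<in> \<I>"
    and "dag p E"
    and "perfect_dag p E"
    and "\<forall>I\<in>\<I>. \<forall>J\<in>\<I>. I \<union> J = ancestral_closure E (I \<union> J)"
  shows "toric_ideal (prob_vars p d \<I>) (factorization_ideal p d E \<I>) \<and>
    (\<exists>r G. monomial_order (prob_vars p d \<I>) r \<and>
       groebner_basis (prob_vars p d \<I>) r G (factorization_ideal p d E \<I>) \<and>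
       (\<forall>g\<in>G. total_degree g = 2) \<and>
       (\<forall>g\<in>G. squarefree_mono (initial_mono r g)) \<and>
       factorization_ideal p d E \<I> = Idl\<^bsub>poly_ring (prob_vars p d \<I>)\<^esub> G)"
proof -
  have edges: "E \<subseteq> {1..p} \<times> {1..p}" and acyclic: "acyclic E"
    using assms(4) by (simp_all add: dag_def)
  have "finite E" using edges by (rule finite_subset) simp
  then obtain \<sigma> where \<sigma>: "bij_betw \<sigma> {1..p} {1..p}"
    "\<forall>s\<in>{1..p}. \<forall>t\<in>{1..p}. (\<sigma> s, \<sigma> t) \<in> E \<longrightarrow> s < t"
    using topological_enumeration[of "{1..p}" E] acyclic by auto
  have "finite \<I>" using assms(2) by (rule finite_subset) simp
  then obtain e :: "nat set \<Rightarrow> nat" where e: "inj_on e \<I>"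
    using finite_imp_inj_to_nat_seg by metis
  interpret perfect_model p d E \<I> \<sigma> e
  proof
    show "(i, j) \<in> E \<or> (j, i) \<in> E" if "(i, k) \<in> E" "(j, k) \<in> E" "i \<noteq> j" for i j k
    proof -
      have "k \<in> {1..p}" using that(1) edges by blast
      then show ?thesis using assms(5) that by (auto simp: perfect_dag_def parents_def)
    qed
    show "i \<in> I" if "I \<in> \<I>" "j \<in> I" "(i, j) \<in> E" for I i j
    proof -
      \<comment> \<open>With both targets equal to \<open>I\<close>, the hypothesis says that
        \<open>I\<close> is its own ancestral closure.\<close>
      have "i \<in> ancestral_closure E (I \<union> I)" using that by (auto simp: ancestral_closure_def)
      then show ?thesis using assms(6) that(1) by blast
    qed
  qed (use assms edges \<sigma> e in auto)
  show ?thesis unfolding factorization_ideal_eq_kernel by (rule kernel_toric_groebner)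
qed

end
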